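(* Let $(W,S)$ be a Vinberg system, with fundamental chamber $C_0$, Tits cone $I$ and Coxeter arrangement $\mathcal{A}$. Let $\varphi : W \times \mathcal{S}^f \to \mathrm{Sal}_0(\mathcal{A})$ be the map defined by $$\varphi(w,X) = (w(\iota(X)),\, w(C_0)).$$ Then $\varphi$ is a bijective map which satisfies the following property: for all $(u,X), (v,Y) \in W \times \mathcal{S}^f$, we have $(u,X) \preceq (v,Y)$ if and only if $\varphi(v,Y) \preceq \varphi(u,X)$.
   Context: **Vinberg systems.** Let $V$ be a finite dimensional real vector space. A reflection on $V$ is a linear transformation of order $2$ fixing a hyperplane pointwise (no orthogonality is assumed). Let $\bar C_0$ be a closed convex polyhedral cone in $V$ with nonempty interior $C_0$, let $H_1, \dots, H_n$ be its walls (the hyperplanes spanned by its codimension $1$ faces), for each $i$ let $s_i$ be a reflection fixing $H_i$, and let $W$ be the subgroup of $\mathrm{GL}(V)$ generated by $S = \{s_1, \dots, s_n\}$. $(W,S)$ is a Vinberg system, with fundamental chamber $C_0$, if $wC_0 \cap C_0 = \emptyset$ for all $w \in W\setminus\{1\}$. Then $(W,S)$ is also a Coxeter system. The Tits cone $I$ is the interior of $\bigcup_{w \in W} w\bar C_0$, a nonempty open convex cone stable under $W$. For a reflection $r \in W$, $H_r$ is its fixed hyperplane; the Coxeter arrangement is $\mathcal{A} = \{H_r \mid r \text{ a reflection in } W\}$, a locally finite family in $I$ all of whose members meet $I$. **Facets.** A chamber of a hyperplane arrangement $\mathcal{A}$ in an open convex cone $I$ is a connected component of $I \setminus \bigcup_{H\in\mathcal{A}}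 H$; $\mathcal{C}(\mathcal{A})$ is the set of chambers. For $H \in \mathcal{A}$ set $I^H = I \cap H$ and $\mathcal{A}^H = \{H' \cap H \mid H' \in \mathcal{A}\setminus\{H\},\ H'\cap H\cap I \neq \emptyset\}$, an arrangement in the cone $I^H$ of $H$. The $0$-codimensional facets are the chambers; for $d \ge 1$, a $d$-codimensional facet of $\mathcal{A}$ is a $(d-1)$-codimensional facet of some $\mathcal{A}^H$, $H\in\mathcal{A}$. $\mathcal{F}(\mathcal{A})$ is the set of all facets, partially ordered by $F_1 \preceq F_2$ if $F_1 \subseteq \bar F_2$ (closure in $I$). The support $|F|$ of a facet is its linear span. Set $\mathcal{A}_F = \{H \in \mathcal{A} \mid F \subset H\}$, and for $C \in \mathcal{C}(\mathcal{A})$ let $C_F$ be the chamber of $\mathcal{A}_F$ (as an arrangement in $I$) containing $C$. **The poset $\mathrm{Sal}_0(\mathcal{A})$.** $\mathrm{Sal}_0(\mathcal{A}) = \{(F,C) \in \mathcal{F}(\mathcal{A}) \times \mathcal{C}(\mathcal{A}) \mid F \preceq C\}$, with $(F,C) \preceq (F',C')$ if $F \preceq F'$ and $C_F \subset C'_{F'}$. **The poset $W \times \mathcal{S}^f$.** For $X \subset S$, $W_X$ is the subgroup of $W$ generated by $X$, and $\mathcal{S}^f = \{X \subset S \mid W_X \text{ is finite}\}$. An element $w \in W$ is $(\emptyset,X)$-minimal if it has minimal word length (with respect to $S$) in the coset $wW_X$. The partial order on $W \times \mathcal{S}^f$ is: $(u,X) \preceq (v,Y)$ if $X \subset Y$,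 $v^{-1}u \in W_Y$, and $v^{-1}u$ is $(\emptyset,X)$-minimal. **The map $\iota$.** Let $\mathcal{F}(C_0) = \{F \in \mathcal{F}(\mathcal{A}) \mid F \preceq C_0\}$. It is known (Vinberg) that there is a bijection $\iota : \mathcal{S}^f \to \mathcal{F}(C_0)$ such that $|\iota(X)| = \bigcap_{s \in X} H_s$ for all $X \in \mathcal{S}^f$ (with $\bigcap_{s\in\emptyset} H_s = V$); that is, $\iota(X)$ is the facet $F \preceq C_0$ with support $\bigcap_{s\in X} H_s$. *)

theory Defs
  imports "HOL-Analysis.Analysis" "HOL-Algebra.Generated_Groups"
begin

definition GL :: "('a::real_vector \<Rightarrow> 'a) monoid" where
  "GL = \<lparr>carrier = {f. linear f \<and> bij f}, mult = (\<circ>), one = id\<rparr>"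

lemma group_GL: "group GL"
proof (rule groupI)
  fix f :: "'a \<Rightarrow> 'a" assume "f \<in> carrier GL"
  then have f: "linear f" "bij f" by (auto simp: GL_def)
  have inv: "f (inv_into UNIV f x) = x" "inv_into UNIV f (f x) = x" for x
    using f(2) by (simp_all add: bij_is_surj surj_f_inv_f bij_is_inj)
  have "linear (inv_into UNIV f)"
  proof (rule linearI)
    show "inv_into UNIV f (x + y) = inv_into UNIV f x + inv_into UNIV f y" for x y
      using inv(2)[of "inv_into UNIV f x + inv_into UNIV f y"]
      by (simp add: linear_add[OF f(1)] inv(1))
    show "inv_into UNIV f (c *\<^sub>R x) = c *\<^sub>R inv_into UNIV f x" for c x
      using inv(2)[of "c *\<^sub>R inv_into UNIV f x"]
      by (simp add: linear_cmul[OF f(1)] inv(1))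
  qed
  then show "\<exists>g\<in>carrier GL. g \<otimes>\<^bsub>GL\<^esub> f = \<one>\<^bsub>GL\<^esub>"
    using f(2) by (intro bexI[of _ "inv_into UNIV f"])
      (auto simp: GL_def bij_is_inj bij_imp_bij_inv)
qed (auto simp: GL_def linear_compose bij_comp o_assoc linear_id)

text \<open>No orthogonality with respect to the inner product of the type is required; the inner
  product only serves to provide the topology and the library notion of polyhedron.\<close>

definition reflection :: "('a::euclidean_space \<Rightarrow> 'a) \<Rightarrow> bool" where
  "reflection r \<longleftrightarrow> linear r \<and> r \<noteq> id \<and> r \<circ> r = id \<and>
     (\<exists>H. subspace H \<and> dim H = DIM('a) - 1 \<and> (\<forall>x\<in>H. r x = x))"

definition fixed_space :: "('a \<Rightarrow> 'a) \<Rightarrow> 'a set" where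
  "fixed_space r = {x. r x = x}"

definition walls :: "'a::euclidean_space set \<Rightarrow> 'a set set" where
  "walls K = span ` {F. F facet_of K}"

text \<open>The subgroup of \<open>GL(V)\<close> generated by \<open>X\<close>: it is \<open>W\<close> for \<open>X = S\<close>, and the standard
  parabolic subgroup \<open>W\<^sub>X\<close> for \<open>X \<subseteq> S\<close>.\<close>

definition gen_subgroup :: "('a::real_vector \<Rightarrow> 'a) set \<Rightarrow> ('a \<Rightarrow> 'a) set" where
  "gen_subgroup X = generate GL X"

text \<open>The closed cone \<open>K\<close> is \<open>closure C\<^sub>0\<close> and \<open>interior K\<close> is the fundamental chamber \<open>C\<^sub>0\<close>.
  The bijection expresses that \<open>S\<close> contains exactly one reflection for each wall of \<open>K\<close>.\<close>

definition vinberg_system :: "'a::euclidean_space set \<Rightarrow> ('a \<Rightarrow> 'a) set \<Rightarrow> bool" where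
  "vinberg_system K S \<longleftrightarrow>
     polyhedron K \<and> convex_cone K \<and> interior K \<noteq> {} \<and>
     (\<forall>s\<in>S. reflection s) \<and> bij_betw fixed_space S (walls K) \<and>
     (\<forall>w \<in> gen_subgroup S - {id}. w ` interior K \<inter> interior K = {})"

definition tits_cone :: "'a::euclidean_space set \<Rightarrow> ('a \<Rightarrow> 'a) set \<Rightarrow> 'a set" where
  "tits_cone K S = interior (\<Union>w\<in>gen_subgroup S. w ` K)"

definition coxeter_arrangement :: "('a::euclidean_space \<Rightarrow> 'a) set \<Rightarrow> 'a set set" where
  "coxeter_arrangement S = fixed_space ` {r \<in> gen_subgroup S. reflection r}"

text \<open>Below, \<open>A\<close> is an arrangement in the cone \<open>I\<close>. A restricted arrangement
  \<open>A\<^sup>H\<close> is kept as a set of subsets of the ambient space, so that the smaller vector space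
  \<open>H\<close> in which it lives need not be recorded.\<close>

definition chambers :: "'a::euclidean_space set set \<Rightarrow> 'a set \<Rightarrow> 'a set set" where
  "chambers A I = components (I - \<Union>A)"

definition restrict_arr :: "'a set set \<Rightarrow> 'a set \<Rightarrow> 'a set \<Rightarrow> 'a set set" where
  "restrict_arr A I H = {H' \<inter> H | H'. H' \<in> A - {H} \<and> H' \<inter> H \<inter> I \<noteq> {}}"

fun codim_facets :: "nat \<Rightarrow> 'a::euclidean_space set set \<Rightarrow> 'a set \<Rightarrow> 'a set set" where
  "codim_facets 0 A I = chambers A I"
| "codim_facets (Suc d) A I = (\<Union>H\<in>A. codim_facets d (restrict_arr A I H) (I \<inter> H))"

definition facets :: "'a::euclidean_space set set \<Rightarrow> 'a set \<Rightarrow> 'a set set" where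
  "facets A I = (\<Union>d. codim_facets d A I)"

definition facet_le :: "'a::euclidean_space set \<Rightarrow> 'a set \<Rightarrow> 'a set \<Rightarrow> bool" where
  "facet_le I F\<^sub>1 F\<^sub>2 \<longleftrightarrow> F\<^sub>1 \<subseteq> closure F\<^sub>2 \<inter> I"

definition localized_arr :: "'a set set \<Rightarrow> 'a set \<Rightarrow> 'a set set" where
  "localized_arr A F = {H \<in> A. F \<subseteq> H}"

definition localized_chamber ::
    "'a::euclidean_space set set \<Rightarrow> 'a set \<Rightarrow> 'a set \<Rightarrow> 'a set \<Rightarrow> 'a set" where
  "localized_chamber A I F C = (THE D. D \<in> chambers (localized_arr A F) I \<and> C \<subseteq> D)"

definition Sal0 :: "'a::euclidean_space set set \<Rightarrow> 'a set \<Rightarrow> ('a set \<times> 'a set) set" where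
  "Sal0 A I = {(F, C). F \<in> facets A I \<and> C \<in> chambers A I \<and> facet_le I F C}"

definition Sal0_le ::
    "'a::euclidean_space set set \<Rightarrow> 'a set \<Rightarrow> 'a set \<times> 'a set \<Rightarrow> 'a set \<times> 'a set \<Rightarrow> bool" where
  "Sal0_le A I = (\<lambda>(F, C) (F', C').
     facet_le I F F' \<and> localized_chamber A I F C \<subseteq> localized_chamber A I F' C')"

definition finite_type_subsets :: "('a::real_vector \<Rightarrow> 'a) set \<Rightarrow> ('a \<Rightarrow> 'a) set set" where
  "finite_type_subsets S = {X. X \<subseteq> S \<and> finite (gen_subgroup X)}"

text \<open>The generators in \<open>S\<close> are involutions, so words in \<open>S\<close> suffice.\<close>

definition word_length :: "('a \<Rightarrow> 'a) set \<Rightarrow> ('a \<Rightarrow> 'a) \<Rightarrow> nat" where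
  "word_length S w = (LEAST n. \<exists>ss. length ss = n \<and> set ss \<subseteq> S \<and> foldr (\<circ>) ss id = w)"

definition empty_minimal ::
    "('a::real_vector \<Rightarrow> 'a) set \<Rightarrow> ('a \<Rightarrow> 'a) set \<Rightarrow> ('a \<Rightarrow> 'a) \<Rightarrow> bool" where
  "empty_minimal S X w \<longleftrightarrow> w \<in> gen_subgroup S \<and>
     (\<forall>w' \<in> w <#\<^bsub>GL\<^esub> gen_subgroup X. word_length S w \<le> word_length S w')"

definition WSf_le :: "('a::real_vector \<Rightarrow> 'a) set \<Rightarrow>
    ('a \<Rightarrow> 'a) \<times> ('a \<Rightarrow> 'a) set \<Rightarrow> ('a \<Rightarrow> 'a) \<times> ('a \<Rightarrow> 'a) set \<Rightarrow> bool" where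
  "WSf_le S = (\<lambda>(u, X) (v, Y). X \<subseteq> Y \<and>
     inv\<^bsub>GL\<^esub> v \<otimes>\<^bsub>GL\<^esub> u \<in> gen_subgroup Y \<and>
     empty_minimal S X (inv\<^bsub>GL\<^esub> v \<otimes>\<^bsub>GL\<^esub> u))"

definition chamber_facets :: "'a::euclidean_space set \<Rightarrow> ('a \<Rightarrow> 'a) set \<Rightarrow> 'a set set" where
  "chamber_facets K S = {F \<in> facets (coxeter_arrangement S) (tits_cone K S).
     facet_le (tits_cone K S) F (interior K)}"

text \<open>By a theorem of Vinberg there is exactly one facet as described, for every \<open>X\<close> with
  \<open>gen_subgroup X\<close> finite. For empty \<open>X\<close> the intersection is the whole space.\<close>

definition iota ::
    "'a::euclidean_space set \<Rightarrow> ('a \<Rightarrow> 'a) set \<Rightarrow> ('a \<Rightarrow> 'a) set \<Rightarrow> 'a set" where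
  "iota K S X = (THE F. F \<in> chamber_facets K S \<and> span F = (\<Inter>s\<in>X. fixed_space s))"

definition phi :: "'a::euclidean_space set \<Rightarrow> ('a \<Rightarrow> 'a) set \<Rightarrow>
    ('a \<Rightarrow> 'a) \<times> ('a \<Rightarrow> 'a) set \<Rightarrow> 'a set \<times> 'a set" where
  "phi K S = (\<lambda>(w, X). (w ` iota K S X, w ` interior K))"

end

theory Submission
  imports Defs
begin

text \<open>Everything is read off from sides of hyperplanes. Two adjacent chambers \<open>u C\<^sub>0\<close> and
  \<open>u s C\<^sub>0\<close> are separated only by \<open>u H\<^sub>s\<close>, so a gallery from \<open>C\<^sub>0\<close> to \<open>w C\<^sub>0\<close> yields the strong
  exchange condition: \<open>H\<^sub>r\<close> separates \<open>C\<^sub>0\<close> and \<open>w C\<^sub>0\<close> only if \<open>r w\<close> is shorter than \<open>w\<close>. It follows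
  that \<open>w x = x\<close> and \<open>w \<in> W\<^bsub>X(x)\<^esub>\<close> whenever \<open>x\<close> and \<open>w x\<close> lie in the closed chamber \<open>K\<close>, where
  \<open>X(x)\<close> are the walls through \<open>x\<close>; that the union of the \<open>w K\<close> is convex; and that \<open>x \<in> K\<close> lies in
  the Tits cone if and only if \<open>W\<^bsub>X(x)\<^esub>\<close> is finite. Hence \<open>\<iota>(X)\<close> is the set of points of \<open>K\<close> lying
  on exactly the walls in \<open>X\<close>, and every facet is a \<open>W\<close>-translate of such a set.

  For the order, \<open>v \<iota>(Y)\<close> lies in the closure of \<open>u \<iota>(X)\<close> if and only if \<open>X \<subseteq> Y\<close> and
  \<open>v\<inverse> u \<in> W\<^sub>Y\<close>. Given this, the inclusion of localized chambers says that no hyperplane containing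
  \<open>u \<iota>(X)\<close> separates \<open>u C\<^sub>0\<close> from \<open>v C\<^sub>0\<close>, which by strong exchange is the minimality of
  \<open>v\<inverse> u\<close> in its coset of \<open>W\<^sub>X\<close>.\<close>


section \<open>Hyperplanes and reflections\<close>

definition linear_hyperplane :: "'a::euclidean_space set \<Rightarrow> bool" where
  "linear_hyperplane H \<longleftrightarrow> (\<exists>a. a \<noteq> 0 \<and> H = {x. a \<bullet> x = 0})"

lemma linear_hyperplane_subspace: "linear_hyperplane H \<Longrightarrow> subspace H"
  by (auto simp: linear_hyperplane_def subspace_hyperplane)

lemma linear_hyperplane_not_UNIV:
  assumes "linear_hyperplane H"
  shows "\<not> UNIV \<subseteq> H"
proof -
  obtain a where "a \<noteq> 0" "H = {x. a \<bullet> x = 0}" using assms by (auto simp: linear_hyperplane_def)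
  then have "a \<notin> H" by simp
  then show ?thesis by blast
qed

lemma linear_hyperplane_subset_eq:
  assumes "linear_hyperplane H" "linear_hyperplane H'" "H \<subseteq> H'"
  shows "H = H'"
proof (rule subspace_dim_equal)
  show "dim H' \<le> dim H"
    using assms(1,2) by (auto simp: linear_hyperplane_def dim_hyperplane)
qed (use assms in \<open>auto intro: linear_hyperplane_subspace\<close>)

text \<open>A fixed point off the hyperplane \<open>H\<close> would force every vector to be fixed,
  so the fixed space is exactly \<open>H\<close>. Since \<open>r\<close> is an involution,
  \<open>x + r x\<close> is fixed, and the normal therefore changes sign under \<open>r\<close>,
  whether or not \<open>r\<close> is orthogonal.\<close>

lemma reflection_normal:
  fixes r :: "'a::euclidean_space \<Rightarrow> 'a"
  assumes "reflection r"
  obtains a where "a \<noteq> 0" "fixed_space r = {x. a \<bullet> x = 0}" "\<And>x. a \<bullet> r x = - (a \<bullet> x)"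
proof -
  obtain H where r: "linear r" "r \<noteq> id" "r \<circ> r = id"
    and H: "subspace H" "dim H = DIM('a) - 1" "\<And>x. x \<in> H \<Longrightarrow> r x = x"
    using assms by (auto simp: reflection_def)
  have "dim H < DIM('a)" using H(2) DIM_positive[where 'a='a] by linarith
  then obtain a where a: "a \<noteq> 0" "span H \<subseteq> {x. a \<bullet> x = 0}"
    using lowdim_subset_hyperplane by blast
  have Ha: "H = {x. a \<bullet> x = 0}"
    by (rule subspace_dim_equal)
      (use a H span_superset in \<open>auto simp: subspace_hyperplane dim_hyperplane\<close>)
  have fixed: "fixed_space r = {x. a \<bullet> x = 0}"
  proof
    show "{x. a \<bullet> x = 0} \<subseteq> fixed_space r" using H Ha by (auto simp: fixed_space_def)
    show "fixed_space r \<subseteq> {x. a \<bullet> x = 0}"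
    proof (rule ccontr)
      assume "\<not> fixed_space r \<subseteq> {x. a \<bullet> x = 0}"
      then obtain x where x: "r x = x" "a \<bullet> x \<noteq> 0" by (auto simp: fixed_space_def)
      have "r y = y" for y
      proof -
        \<comment> \<open>With this factor, subtracting a multiple of the fixed vector
          \<open>x\<close> brings \<open>y\<close> into \<open>H\<close>.\<close>
        define k where "k = (a \<bullet> y) / (a \<bullet> x)"
        have "y - k *\<^sub>R x \<in> H" using x by (simp add: Ha k_def inner_diff_right)
        then have "r (y - k *\<^sub>R x) = y - k *\<^sub>R x" by (rule H)
        then show ?thesis using x by (simp add: linear_diff[OF r(1)] linear_cmul[OF r(1)])
      qed
      then show False using r(2) by auto
    qed
  qed
  have "a \<bullet> r x = - (a \<bullet> x)" for x
  proof -
    have "r (r x) = x" using r(3) by (metis comp_apply id_apply)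
    then have "x + r x \<in> fixed_space r" by (simp add: fixed_space_def linear_add[OF r(1)])
    then show ?thesis by (simp add: fixed inner_add_right)
  qed
  then show thesis using that a(1) fixed by blast
qed

lemma reflection_hyperplane: "reflection r \<Longrightarrow> linear_hyperplane (fixed_space r)"
  by (erule reflection_normal) (auto simp: linear_hyperplane_def)

abbreviation inv_map :: "('a \<Rightarrow> 'a) \<Rightarrow> 'a \<Rightarrow> 'a" where
  "inv_map u \<equiv> inv_into UNIV u"

lemma reflection_conj:
  assumes r: "reflection r" and u: "linear u" "bij u"
  shows "reflection (u \<circ> r \<circ> inv_map u)" "fixed_space (u \<circ> r \<circ> inv_map u) = u ` fixed_space r"
proof -
  let ?q = "u \<circ> r \<circ> inv_map u"
  have iv: "inv_map u (u x) = x" "u (inv_map u x) = x" for x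
    using u(2) by (simp_all add: bij_is_inj bij_is_surj surj_f_inv_f)
  have "linear (inv_map u)" using u by (simp add: bij_is_inj inj_linear_imp_inv_linear)
  then have "linear ?q" using u(1) r by (intro linear_compose) (auto simp: reflection_def)
  obtain H where r': "r \<noteq> id" "r \<circ> r = id"
    and H: "subspace H" "dim H = DIM('a) - 1" "\<And>x. x \<in> H \<Longrightarrow> r x = x"
    using r by (auto simp: reflection_def)
  have "?q \<noteq> id"
  proof
    assume q: "?q = id"
    have "r x = x" for x using fun_cong[OF q, of "u x"] iv by (metis comp_apply id_apply)
    then show False using r' by auto
  qed
  moreover have "?q \<circ> ?q = id"
    using pointfree_idE[OF r'(2)] by (auto simp: iv)
  moreover have "subspace (u ` H)" using u(1) H(1) by (rule linear_subspace_image)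
  moreover have "dim (u ` H) = DIM('a) - 1"
    using dim_image_eq[of u H] u H(2) inj_on_subset[OF bij_is_inj[OF u(2)], of "span H"] by simp
  moreover have "\<forall>x\<in>u ` H. ?q x = x" using H(3) by (auto simp: iv)
  ultimately show "reflection ?q" using \<open>linear ?q\<close> unfolding reflection_def by blast
  show "fixed_space ?q = u ` fixed_space r"
  proof (intro equalityI subsetI)
    fix x assume "x \<in> fixed_space ?q"
    then have "u (r (inv_map u x)) = x" by (simp add: fixed_space_def)
    then have "r (inv_map u x) = inv_map u x" by (metis iv(1))
    then have "inv_map u x \<in> fixed_space r" by (simp add: fixed_space_def)
    then show "x \<in> u ` fixed_space r" by (rule rev_image_eqI) (simp add: iv)
  qed (auto simp: fixed_space_def iv)
qed

text \<open>Phrased by segments rather than by a normal vector, so that it involves no choice of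
  normal and is visibly invariant under linear bijections. A point on \<open>H\<close> is never
  separated from anything.\<close>

definition separates :: "'a::euclidean_space set \<Rightarrow> 'a \<Rightarrow> 'a \<Rightarrow> bool" where
  "separates H x y \<longleftrightarrow> x \<notin> H \<and> y \<notin> H \<and> closed_segment x y \<inter> H \<noteq> {}"

lemma separates_iff: "separates {z. a \<bullet> z = 0} x y \<longleftrightarrow> (a \<bullet> x) * (a \<bullet> y) < 0"
proof
  assume "separates {z. a \<bullet> z = 0} x y"
  then obtain u where u: "0 \<le> u" "u \<le> 1" "a \<bullet> ((1 - u) *\<^sub>R x + u *\<^sub>R y) = 0"
    and n: "a \<bullet> x \<noteq> 0" "a \<bullet> y \<noteq> 0"
    by (auto simp: separates_def closed_segment_def)
  have e: "(1 - u) * (a \<bullet> x) + u * (a \<bullet> y) = 0" using u(3) by (simp add: inner_add_right)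
  show "(a \<bullet> x) * (a \<bullet> y) < 0"
  proof (rule ccontr)
    assume "\<not> ?thesis"
    then have p: "(a \<bullet> x) * (a \<bullet> y) > 0" using n by (metis linorder_neqE_linordered_idom mult_eq_0_iff)
    \<comment> \<open>Multiplying by \<open>a \<bullet> x\<close> makes both summands nonnegative if
      the signs agree, so both must vanish.\<close>
    have "(1 - u) * (a \<bullet> x)^2 + u * ((a \<bullet> x) * (a \<bullet> y)) = 0"
      using arg_cong[OF e, of "\<lambda>t. (a \<bullet> x) * t"] by (simp add: algebra_simps power2_eq_square)
    moreover have "(1 - u) * (a \<bullet> x)^2 \<ge> 0" "u * ((a \<bullet> x) * (a \<bullet> y)) \<ge> 0"
      using u p by auto
    ultimately have "(1 - u) * (a \<bullet> x)^2 = 0" "u * ((a \<bullet> x) * (a \<bullet> y)) = 0" by linarith+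
    then show False using n p by auto
  qed
next
  assume p: "(a \<bullet> x) * (a \<bullet> y) < 0"
  \<comment> \<open>The parameter at which the segment from \<open>x\<close> to \<open>y\<close>
    crosses the hyperplane.\<close>
  define u where "u = (a \<bullet> x) / (a \<bullet> x - a \<bullet> y)"
  have d: "a \<bullet> x - a \<bullet> y \<noteq> 0" using p by (auto simp: not_less)
  have u: "0 \<le> u" "u \<le> 1" using p unfolding u_def mult_less_0_iff
    by (auto simp: field_simps)
  have "(1 - u) * (a \<bullet> x) + u * (a \<bullet> y) = 0" using d unfolding u_def by (simp add: field_simps)
  then have "a \<bullet> ((1 - u) *\<^sub>R x + u *\<^sub>R y) = 0" by (simp add: inner_add_right)
  then show "separates {z. a \<bullet> z = 0} x y" using p u
    unfolding separates_def closed_segment_def by fastforce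
qed

lemma separates_image:
  assumes "linear w" "bij w"
  shows "separates (w ` H) (w x) (w y) \<longleftrightarrow> separates H x y"
  using assms by (simp add: separates_def closed_segment_linear_image bij_is_inj inj_image_mem_iff
      flip: image_Int)

lemma separates_sym: "separates H x y \<longleftrightarrow> separates H y x"
  by (auto simp: separates_def closed_segment_commute)

text \<open>A hyperplane has only two sides, so crossings add modulo two.\<close>

lemma separates_trans:
  assumes "linear_hyperplane H" "x \<notin> H" "y \<notin> H" "z \<notin> H"
  shows "separates H x z \<longleftrightarrow> separates H x y \<noteq> separates H y z"
  using assms by (auto simp: linear_hyperplane_def separates_iff mult_less_0_iff)

lemma reflection_separates:
  assumes "reflection r" "x \<notin> fixed_space r"
  shows "separates (fixed_space r) x (r x)"
  using assms(1)
proof (rule reflection_normal)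
  fix a assume a: "fixed_space r = {x. a \<bullet> x = 0}" "\<And>x. a \<bullet> r x = - (a \<bullet> x)"
  then show ?thesis using assms(2) by (auto simp: separates_iff mult_less_0_iff)
qed


section \<open>Cells of an arrangement\<close>

text \<open>The points of \<open>I\<close> with the same sign vector as \<open>p\<close>: the
  chamber of \<open>p\<close> if \<open>p\<close> is on no hyperplane, and otherwise a relatively
  open piece of the intersection of the hyperplanes through \<open>p\<close>.\<close>

definition cell :: "'a::euclidean_space set set \<Rightarrow> 'a set \<Rightarrow> 'a \<Rightarrow> 'a set" where
  "cell A I p = {x \<in> I. \<forall>H\<in>A. (x \<in> H \<longleftrightarrow> p \<in> H) \<and> \<not> separates H p x}"

text \<open>Each \<open>H\<close> imposes either the hyperplane itself or one of its open
  half-spaces, depending on the sign of its normal at \<open>p\<close>.\<close>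

lemma convex_cell:
  assumes "convex I" "\<And>H. H \<in> A \<Longrightarrow> linear_hyperplane H"
  shows "convex (cell A I p)"
proof -
  have "convex {x. (x \<in> H \<longleftrightarrow> p \<in> H) \<and> \<not> separates H p x}" if H_A: "H \<in> A" for H
  proof -
    obtain a where H: "H = {x. a \<bullet> x = 0}"
      using assms(2)[OF H_A] by (auto simp: linear_hyperplane_def)
    consider "a \<bullet> p = 0" | "a \<bullet> p > 0" | "a \<bullet> p < 0" by linarith
    then show ?thesis
    proof cases
      case 1
      then have "{x. (x \<in> H \<longleftrightarrow> p \<in> H) \<and> \<not> separates H p x} = {x. a \<bullet> x = 0}"
        by (auto simp: H separates_iff)
      then show ?thesis by (simp add: convex_hyperplane)
    next
      case 2
      then have "{x. (x \<in> H \<longleftrightarrow> p \<in> H) \<and> \<not> separates H p x} = {x. a \<bullet> x > 0}"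
        by (auto simp: H separates_iff mult_less_0_iff)
      then show ?thesis by (simp add: convex_halfspace_gt)
    next
      case 3
      then have "{x. (x \<in> H \<longleftrightarrow> p \<in> H) \<and> \<not> separates H p x} = {x. a \<bullet> x < 0}"
        by (auto simp: H separates_iff mult_less_0_iff)
      then show ?thesis by (simp add: convex_halfspace_lt)
    qed
  qed
  then have "convex (I \<inter> (\<Inter>H\<in>A. {x. (x \<in> H \<longleftrightarrow> p \<in> H) \<and> \<not> separates H p x}))"
    using assms(1) by (intro convex_Int convex_INT) auto
  moreover have "cell A I p = I \<inter> (\<Inter>H\<in>A. {x. (x \<in> H \<longleftrightarrow> p \<in> H) \<and> \<not> separates H p x})"
    by (auto simp: cell_def)
  ultimately show ?thesis by simp
qed

lemma mem_cell_self:
  assumes "p \<in> I" "\<And>H. H \<in> A \<Longrightarrow> linear_hyperplane H"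
  shows "p \<in> cell A I p"
proof -
  have "\<not> separates H p p" if "H \<in> A" for H
    using assms(2)[OF that] by (auto simp: linear_hyperplane_def separates_iff not_less)
  then show ?thesis using assms(1) by (simp add: cell_def)
qed

section \<open>Flats and their connected components\<close>

definition flat :: "'a::euclidean_space set set \<Rightarrow> 'a set \<Rightarrow> bool" where
  "flat A L \<longleftrightarrow> L = \<Inter>{H \<in> A. L \<subseteq> H}"

lemma flat_UNIV: "(\<And>H. H \<in> A \<Longrightarrow> linear_hyperplane H) \<Longrightarrow> flat A UNIV"
  using linear_hyperplane_not_UNIV by (auto simp: flat_def)

lemma flat_Int: "flat A L \<Longrightarrow> H \<in> A \<Longrightarrow> flat A (H \<inter> L)"
  unfolding flat_def by blast

lemma flat_subspace:
  assumes "flat A L" "\<And>H. H \<in> A \<Longrightarrow> linear_hyperplane H"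
  shows "subspace L"
proof -
  have "subspace (\<Inter>{H \<in> A. L \<subseteq> H})"
    using assms(2) by (intro subspace_Inter) (auto intro: linear_hyperplane_subspace)
  then show ?thesis using assms(1) by (simp add: flat_def)
qed

text \<open>Cells are convex, and a connected set missing a hyperplane stays on one side of it.\<close>

lemma connected_component_cell:
  assumes "convex I" and hyp: "\<And>H. H \<in> A \<Longrightarrow> linear_hyperplane H"
    and "flat A L" and p: "p \<in> I" "p \<in> L" "\<And>H. H \<in> A \<Longrightarrow> p \<in> H \<Longrightarrow> L \<subseteq> H"
  shows "connected_component_set (I \<inter> L - \<Union>{H \<in> A. \<not> L \<subseteq> H}) p = cell A I p" (is "?Q = _")
proof
  have L: "x \<in> L \<longleftrightarrow> (\<forall>H\<in>A. L \<subseteq> H \<longrightarrow> x \<in> H)" for x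
    using assms(3) unfolding flat_def by blast
  have "cell A I p \<subseteq> I \<inter> L - \<Union>{H \<in> A. \<not> L \<subseteq> H}"
  proof
    fix x assume x: "x \<in> cell A I p"
    then have "x \<in> L" using p(2) L by (auto simp: cell_def)
    then show "x \<in> I \<inter> L - \<Union>{H \<in> A. \<not> L \<subseteq> H}" using x p(3) by (auto simp: cell_def)
  qed
  then show "cell A I p \<subseteq> ?Q"
    by (intro connected_component_maximal mem_cell_self convex_connected convex_cell assms)
  show "?Q \<subseteq> cell A I p"
  proof
    fix x assume x: "x \<in> ?Q"
    then have x': "x \<in> I" "x \<in> L" "\<And>H. H \<in> A \<Longrightarrow> x \<in> H \<Longrightarrow> L \<subseteq> H"
      using connected_component_subset[of "I \<inter> L - \<Union>{H \<in> A. \<not> L \<subseteq> H}" p] by auto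
    have pQ: "p \<in> ?Q" using x by (metis connected_component_refl connected_component_eq_empty
          connected_component_in empty_iff mem_Collect_eq)
    have "\<not> separates H p x" if H: "H \<in> A" for H
    proof
      assume s: "separates H p x"
      obtain a where a: "H = {x. a \<bullet> x = 0}"
        using assms(2)[OF H] by (auto simp: linear_hyperplane_def)
      have s': "(a \<bullet> p) * (a \<bullet> x) < 0" using s by (simp add: a separates_iff)
      have "\<exists>z\<in>?Q. a \<bullet> z = 0"
      proof (cases "a \<bullet> p < 0")
        case True
        then have "a \<bullet> p \<le> 0" "0 \<le> a \<bullet> x" using s' by (auto simp: mult_less_0_iff)
        then show ?thesis
          using connected_ivt_hyperplane[OF connected_connected_component pQ x] by blast
      next
        case False
        then have "a \<bullet> x \<le> 0" "0 \<le> a \<bullet> p" using s' by (auto simp: mult_less_0_iff)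
        then show ?thesis
          using connected_ivt_hyperplane[OF connected_connected_component x pQ] by blast
      qed
      then obtain z where z: "z \<in> ?Q" "z \<in> H" by (auto simp: a)
      then have "z \<in> I \<inter> L - \<Union>{H \<in> A. \<not> L \<subseteq> H}" using connected_component_subset by blast
      then have "L \<subseteq> H" using z(2) H by blast
      then show False using s p(2) by (auto simp: separates_def)
    qed
    moreover have "x \<in> H \<longleftrightarrow> p \<in> H" if "H \<in> A" for H
      using that x' p by blast
    ultimately show "x \<in> cell A I p" using x' by (auto simp: cell_def)
  qed
qed

lemma components_flat:
  assumes "convex I" "\<And>H. H \<in> A \<Longrightarrow> linear_hyperplane H" "flat A L"
  shows "components (I \<inter> L - \<Union>{H \<in> A. \<not> L \<subseteq> H})
    = cell A I ` {p \<in> I \<inter> L. \<forall>H\<in>A. p \<in> H \<longrightarrow> L \<subseteq> H}"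
proof -
  have "I \<inter> L - \<Union>{H \<in> A. \<not> L \<subseteq> H} = {p \<in> I \<inter> L. \<forall>H\<in>A. p \<in> H \<longrightarrow> L \<subseteq> H}" by auto
  then show ?thesis
    unfolding components_def using connected_component_cell[OF assms(1,2,3)]
    by (intro image_cong) auto
qed

lemma chambers_eq_cells:
  assumes "convex I" "\<And>H. H \<in> A \<Longrightarrow> linear_hyperplane H"
  shows "chambers A I = cell A I ` (I - \<Union>A)"
proof -
  have "{H \<in> A. \<not> UNIV \<subseteq> H} = A" "{p \<in> I \<inter> UNIV. \<forall>H\<in>A. p \<in> H \<longrightarrow> UNIV \<subseteq> H} = I - \<Union>A"
    using linear_hyperplane_not_UNIV assms(2) by auto
  then show ?thesis
    using components_flat[of I A UNIV] assms flat_UNIV[of A] by (simp add: chambers_def)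
qed

text \<open>The arrangement that iterated restriction produces on a flat \<open>L\<close>. As in
  \<open>restrict_arr\<close>, traces that miss \<open>I\<close> are dropped.\<close>

definition trace_arr :: "'a set set \<Rightarrow> 'a set \<Rightarrow> 'a set \<Rightarrow> 'a set set" where
  "trace_arr A I L = {H \<inter> L | H. H \<in> A \<and> \<not> L \<subseteq> H \<and> H \<inter> L \<inter> I \<noteq> {}}"

text \<open>\<open>H \<inter> L\<close> has codimension at most one in \<open>L\<close>, so a
  subspace containing it and a further vector \<open>x\<close> of \<open>L\<close> already contains
  all of \<open>L\<close>.\<close>

lemma hyperplane_trace_eq:
  assumes "linear_hyperplane H" "subspace L" "subspace H'" "H \<inter> L \<subseteq> H'" "\<not> L \<subseteq> H'"
  shows "H' \<inter> L \<subseteq> H \<inter> L"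
proof
  obtain a where a: "H = {x. a \<bullet> x = 0}" using assms(1) by (auto simp: linear_hyperplane_def)
  fix x assume x: "x \<in> H' \<inter> L"
  have "a \<bullet> x = 0"
  proof (rule ccontr)
    assume n: "a \<bullet> x \<noteq> 0"
    have "y \<in> H'" if y: "y \<in> L" for y
    proof -
      define k where "k = (a \<bullet> y) / (a \<bullet> x)"
      have "y - k *\<^sub>R x \<in> H \<inter> L" using x y n assms(2)
        by (simp add: a k_def inner_diff_right subspace_diff subspace_scale)
      then have "y - k *\<^sub>R x + k *\<^sub>R x \<in> H'"
        using assms(3,4) x by (intro subspace_add) (auto simp: subspace_scale)
      then show ?thesis by simp
    qed
    then show False using assms(5) by blast
  qed
  then show "x \<in> H \<inter> L" using x a by simp
qed

text \<open>Restrictions compose, which replaces the recursion of \<open>codim_facets\<close> by a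
  walk through flats. The point is that a hyperplane contains \<open>H \<inter> L\<close> only if it
  contains \<open>L\<close> or has the same trace on \<open>L\<close> as \<open>H\<close>; these are
  exactly the hyperplanes that both sides discard.\<close>

lemma restrict_trace_arr:
  assumes hyp: "\<And>H. H \<in> A \<Longrightarrow> linear_hyperplane H" and L: "subspace L" and H: "H \<in> A" "\<not> L \<subseteq> H"
  shows "restrict_arr (trace_arr A I L) (I \<inter> L) (H \<inter> L) = trace_arr A I (H \<inter> L)"
proof -
  have *: "H \<inter> L \<subseteq> H' \<longleftrightarrow> L \<subseteq> H' \<or> H' \<inter> L = H \<inter> L" if "H' \<in> A" for H'
  proof
    assume s: "H \<inter> L \<subseteq> H'"
    show "L \<subseteq> H' \<or> H' \<inter> L = H \<inter> L"
    proof (cases "L \<subseteq> H'")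
      case False
      have "H' \<inter> L \<subseteq> H \<inter> L"
        using hyperplane_trace_eq[OF hyp[OF H(1)] L _ s False] hyp[OF that]
        by (simp add: linear_hyperplane_subspace)
      then show ?thesis using s by auto
    qed auto
  qed auto
  show ?thesis
  proof (intro equalityI subsetI)
    fix Z assume "Z \<in> restrict_arr (trace_arr A I L) (I \<inter> L) (H \<inter> L)"
    then obtain H' where "H' \<in> A" "\<not> L \<subseteq> H'" "H' \<inter> L \<noteq> H \<inter> L"
      "H' \<inter> L \<inter> (H \<inter> L) \<inter> (I \<inter> L) \<noteq> {}" "Z = H' \<inter> L \<inter> (H \<inter> L)"
      by (auto simp: restrict_arr_def trace_arr_def)
    then show "Z \<in> trace_arr A I (H \<inter> L)" using * by (auto simp: trace_arr_def)
  next
    fix Z assume "Z \<in> trace_arr A I (H \<inter> L)"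
    then obtain H' where H': "H' \<in> A" "\<not> H \<inter> L \<subseteq> H'" "H' \<inter> (H \<inter> L) \<inter> I \<noteq> {}" "Z = H' \<inter> (H \<inter> L)"
      by (auto simp: trace_arr_def)
    then have "H' \<inter> L \<in> trace_arr A I L - {H \<inter> L}" using *[OF H'(1)] by (auto simp: trace_arr_def)
    moreover have "Z = (H' \<inter> L) \<inter> (H \<inter> L)" "(H' \<inter> L) \<inter> (H \<inter> L) \<inter> (I \<inter> L) \<noteq> {}" using H' by auto
    ultimately show "Z \<in> restrict_arr (trace_arr A I L) (I \<inter> L) (H \<inter> L)"
      unfolding restrict_arr_def by blast
  qed
qed

lemma codim_facets_empty: "codim_facets d {} {} = {}"
  by (cases d) (auto simp: chambers_def)

section \<open>Recursively defined facets as cells\<close>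

context
  fixes A :: "'a::euclidean_space set set" and I :: "'a set"
  assumes conv: "convex I" and hyp: "\<And>H. H \<in> A \<Longrightarrow> linear_hyperplane H"
begin

lemma chambers_trace_arr:
  assumes "flat A L"
  shows "chambers (trace_arr A I L) (I \<inter> L) = cell A I ` {p \<in> I \<inter> L. \<forall>H\<in>A. p \<in> H \<longrightarrow> L \<subseteq> H}"
proof -
  have "I \<inter> L - \<Union>(trace_arr A I L) = I \<inter> L - \<Union>{H \<in> A. \<not> L \<subseteq> H}"
    by (auto simp: trace_arr_def)
  then show ?thesis using components_flat[OF conv hyp assms] by (simp add: chambers_def)
qed

lemma codim_facets_trace_arr_Suc:
  assumes "flat A L"
  shows "codim_facets (Suc d) (trace_arr A I L) (I \<inter> L)
    = (\<Union>H\<in>{H \<in> A. \<not> L \<subseteq> H \<and> H \<inter> L \<inter> I \<noteq> {}}. codim_facets d (trace_arr A I (H \<inter> L)) (I \<inter> (H \<inter> L)))"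
proof -
  have e: "trace_arr A I L = (\<lambda>H. H \<inter> L) ` {H \<in> A. \<not> L \<subseteq> H \<and> H \<inter> L \<inter> I \<noteq> {}}"
    by (auto simp: trace_arr_def)
  have "codim_facets d (restrict_arr (trace_arr A I L) (I \<inter> L) (H \<inter> L)) (I \<inter> L \<inter> (H \<inter> L))
    = codim_facets d (trace_arr A I (H \<inter> L)) (I \<inter> (H \<inter> L))"
    if "H \<in> {H \<in> A. \<not> L \<subseteq> H \<and> H \<inter> L \<inter> I \<noteq> {}}" for H
  proof -
    have "I \<inter> L \<inter> (H \<inter> L) = I \<inter> (H \<inter> L)" by auto
    moreover have "restrict_arr (trace_arr A I L) (I \<inter> L) (H \<inter> L) = trace_arr A I (H \<inter> L)"
      using that flat_subspace[OF assms hyp] hyp by (intro restrict_trace_arr) auto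
    ultimately show ?thesis by simp
  qed
  then have "(\<Union>H\<in>trace_arr A I L.
        codim_facets d (restrict_arr (trace_arr A I L) (I \<inter> L) H) (I \<inter> L \<inter> H))
    = (\<Union>H\<in>{H \<in> A. \<not> L \<subseteq> H \<and> H \<inter> L \<inter> I \<noteq> {}}. codim_facets d (trace_arr A I (H \<inter> L)) (I \<inter> (H \<inter> L)))"
    by (subst e, subst image_image) (rule SUP_cong[OF refl])
  then show ?thesis by simp
qed

lemma codim_facets_subset_cells:
  "flat A L \<Longrightarrow> codim_facets d (trace_arr A I L) (I \<inter> L) \<subseteq> cell A I ` (I \<inter> L)"
proof (induction d arbitrary: L)
  case 0
  then show ?case using chambers_trace_arr by auto
next
  case (Suc d)
  have "codim_facets d (trace_arr A I (H \<inter> L)) (I \<inter> (H \<inter> L)) \<subseteq> cell A I ` (I \<inter> L)" if "H \<in> A" for H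
    using Suc.IH[OF flat_Int[OF Suc.prems that]] by blast
  then show ?case unfolding codim_facets_trace_arr_Suc[OF Suc.prems] by blast
qed

text \<open>Intersecting \<open>L\<close> with a hyperplane through \<open>p\<close> that does not
  contain \<open>L\<close> lowers the dimension. When no such hyperplane is left, the cell of
  \<open>p\<close> is a chamber of the trace on \<open>L\<close>.\<close>

lemma cell_mem_codim_facets:
  "flat A L \<Longrightarrow> p \<in> I \<inter> L \<Longrightarrow> \<exists>d. cell A I p \<in> codim_facets d (trace_arr A I L) (I \<inter> L)"
proof (induction "dim L" arbitrary: L rule: less_induct)
  case less
  show ?case
  proof (cases "\<forall>H\<in>A. p \<in> H \<longrightarrow> L \<subseteq> H")
    case True
    then have "cell A I p \<in> codim_facets 0 (trace_arr A I L) (I \<inter> L)"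
      using chambers_trace_arr less.prems by auto
    then show ?thesis ..
  next
    case False
    then obtain H where H: "H \<in> A" "p \<in> H" "\<not> L \<subseteq> H" by blast
    have sub: "subspace L" "subspace H" "subspace (H \<inter> L)"
      using less.prems H hyp by (auto intro: flat_subspace linear_hyperplane_subspace subspace_inter)
    have "dim (H \<inter> L) < dim L"
    proof (rule ccontr)
      assume "\<not> ?thesis"
      then have "H \<inter> L = L" using sub by (intro subspace_dim_equal) auto
      then show False using H(3) by auto
    qed
    then obtain d where "cell A I p \<in> codim_facets d (trace_arr A I (H \<inter> L)) (I \<inter> (H \<inter> L))"
      using less.hyps[of "H \<inter> L"] flat_Int[OF less.prems(1) H(1)] less.prems(2) H by auto
    then have "cell A I p \<in> codim_facets (Suc d) (trace_arr A I L) (I \<inter> L)"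
      unfolding codim_facets_trace_arr_Suc[OF less.prems(1)] using H less.prems by blast
    then show ?thesis ..
  qed
qed

text \<open>\<open>A\<close> and its trace on the whole space differ by the hyperplanes missing
  \<open>I\<close>. These remove no points from \<open>I\<close>, and they restrict to the empty
  cone, which carries no facets.\<close>

lemma codim_facets_trace_UNIV: "codim_facets d A I = codim_facets d (trace_arr A I UNIV) (I \<inter> UNIV)"
proof -
  have e: "trace_arr A I UNIV = {H \<in> A. H \<inter> I \<noteq> {}}"
    using linear_hyperplane_not_UNIV[OF hyp] by (auto simp: trace_arr_def)
  show ?thesis
  proof (cases d)
    case 0
    have "I - \<Union>A = I - \<Union>{H \<in> A. H \<inter> I \<noteq> {}}" by auto
    then show ?thesis by (simp add: 0 e chambers_def)
  next
    case (Suc d')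
    have r: "restrict_arr A I H = restrict_arr {H \<in> A. H \<inter> I \<noteq> {}} I H" for H
      by (auto simp: restrict_arr_def)
    have z: "codim_facets d' (restrict_arr A I H) (I \<inter> H) = {}" if "H \<inter> I = {}" for H
    proof -
      have "restrict_arr A I H = {}" "I \<inter> H = {}" using that by (auto simp: restrict_arr_def)
      then show ?thesis by (simp add: codim_facets_empty)
    qed
    have "(\<Union>H\<in>A. codim_facets d' (restrict_arr A I H) (I \<inter> H))
      = (\<Union>H\<in>{H \<in> A. H \<inter> I \<noteq> {}}. codim_facets d' (restrict_arr A I H) (I \<inter> H))"
      using z by blast
    then show ?thesis unfolding Suc e using r by simp
  qed
qed

lemma facets_eq_cells: "facets A I = cell A I ` I"
proof
  show "facets A I \<subseteq> cell A I ` I"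
    using codim_facets_subset_cells[OF flat_UNIV[OF hyp]] codim_facets_trace_UNIV
    by (auto simp: facets_def)
  show "cell A I ` I \<subseteq> facets A I"
    using cell_mem_codim_facets[OF flat_UNIV[OF hyp]] codim_facets_trace_UNIV
    by (fastforce simp: facets_def)
qed

text \<open>Replaces the definite description by the cell of any point of \<open>C\<close>.
  Uniqueness holds because distinct components are disjoint and both candidates contain
  \<open>c\<close>.\<close>

lemma localized_chamber_eq:
  assumes C: "C \<in> chambers A I" and c: "c \<in> C"
  shows "localized_chamber A I F C = cell (localized_arr A F) I c"
proof -
  have hyp': "\<And>H. H \<in> localized_arr A F \<Longrightarrow> linear_hyperplane H" using hyp by (auto simp: localized_arr_def)
  have C': "C = cell A I c" "c \<in> I - \<Union>A"
  proof -
    obtain q where q: "q \<in> I - \<Union>A" "C = cell A I q" using C chambers_eq_cells[OF conv hyp] by auto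
    then show 1: "c \<in> I - \<Union>A" using c by (auto simp: cell_def)
    then have "c \<in> cell A I c" "cell A I c \<in> chambers A I"
      using mem_cell_self hyp chambers_eq_cells[OF conv hyp] by auto
    then show "C = cell A I c"
      using C c components_eq[of C "I - \<Union>A" "cell A I c"] by (auto simp: chambers_def)
  qed
  have D: "cell (localized_arr A F) I c \<in> chambers (localized_arr A F) I"
  proof -
    have "chambers (localized_arr A F) I = cell (localized_arr A F) I ` (I - \<Union>(localized_arr A F))"
      using conv hyp' by (rule chambers_eq_cells)
    then show ?thesis using C'(2) by (auto simp: localized_arr_def)
  qed
  have sub: "C \<subseteq> cell (localized_arr A F) I c"
    unfolding C'(1) by (auto simp: cell_def localized_arr_def)
  show ?thesis
    unfolding localized_chamber_def
  proof (rule the_equality)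
    fix D' assume "D' \<in> chambers (localized_arr A F) I \<and> C \<subseteq> D'"
    then show "D' = cell (localized_arr A F) I c"
      using D sub c components_eq[of D' "I - \<Union>(localized_arr A F)" "cell (localized_arr A F) I c"]
      by (auto simp: chambers_def)
  qed (use D sub in auto)
qed

end


section \<open>Words in the generators\<close>

definition word_prod :: "('a \<Rightarrow> 'a) list \<Rightarrow> 'a \<Rightarrow> 'a" where
  "word_prod ss = foldr (\<circ>) ss id"

lemma word_prod_simps [simp]: "word_prod [] = id" "word_prod (s # ss) = s \<circ> word_prod ss"
  by (simp_all add: word_prod_def)

lemma word_prod_append: "word_prod (xs @ ys) = word_prod xs \<circ> word_prod ys"
  by (induction xs) (simp_all add: o_assoc)

lemma gen_subgroup_linear_bij:
  assumes "w \<in> gen_subgroup X" "\<And>s. s \<in> X \<Longrightarrow> linear s \<and> bij s"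
  shows "linear w" "bij w"
proof -
  have "gen_subgroup X \<subseteq> carrier GL"
    unfolding gen_subgroup_def using assms(2)
    by (intro group.generate_incl[OF group_GL]) (auto simp: GL_def)
  then show "linear w" "bij w" using assms(1) by (auto simp: GL_def)
qed

lemma inv_GL_involution:
  assumes "linear s" "s \<circ> s = id"
  shows "inv\<^bsub>GL\<^esub> s = s"
proof -
  have "s \<in> carrier GL" using assms by (auto simp: GL_def o_bij)
  then show ?thesis
    using group.inv_equality[OF group_GL, of s s] assms(2) by (simp add: GL_def)
qed

text \<open>The generators are their own inverses, so the inverse case of \<open>generate\<close>
  contributes only one-letter words.\<close>

lemma gen_subgroup_words:
  fixes X :: "('a::real_vector \<Rightarrow> 'a) set"
  assumes "\<And>s. s \<in> X \<Longrightarrow> linear s \<and> s \<circ> s = id"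
  shows "gen_subgroup X = {word_prod ss | ss. set ss \<subseteq> X}"
proof (intro equalityI subsetI)
  fix w assume "w \<in> gen_subgroup X"
  then have "w \<in> generate GL X" by (simp add: gen_subgroup_def)
  then show "w \<in> {word_prod ss | ss. set ss \<subseteq> X}"
  proof (induction rule: generate.induct)
    case one
    show ?case by (intro CollectI exI[of _ "[]"]) (simp add: GL_def)
  next
    case (incl h)
    then show ?case by (intro CollectI exI[of _ "[h]"]) simp
  next
    case (inv h)
    then have "inv\<^bsub>GL\<^esub> h = h" using assms inv_GL_involution by blast
    then show ?case using inv by (intro CollectI exI[of _ "[h]"]) simp
  next
    case (eng g h)
    then obtain xs ys where "g = word_prod xs" "h = word_prod ys" "set xs \<subseteq> X" "set ys \<subseteq> X" by blast
    moreover have "g \<otimes>\<^bsub>GL\<^esub> h = g \<circ> h" by (simp add: GL_def)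
    ultimately show ?case by (intro CollectI exI[of _ "xs @ ys"]) (simp add: word_prod_append)
  qed
next
  fix w assume "w \<in> {word_prod ss | ss. set ss \<subseteq> X}"
  then obtain ss where w: "w = word_prod ss" and ss: "set ss \<subseteq> X" by blast
  from ss have "word_prod ss \<in> gen_subgroup X"
  proof (induction ss)
    case Nil
    show ?case using generate.one[of GL X] by (simp add: gen_subgroup_def GL_def id_def)
  next
    case (Cons s ss)
    then have "s \<in> gen_subgroup X" "word_prod ss \<in> gen_subgroup X"
      by (auto simp: gen_subgroup_def intro: generate.incl)
    then have "s \<otimes>\<^bsub>GL\<^esub> word_prod ss \<in> gen_subgroup X"
      unfolding gen_subgroup_def by (rule generate.eng)
    then show ?case by (simp add: GL_def comp_def)
  qed
  then show "w \<in> gen_subgroup X" by (simp only: w)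
qed

lemma word_length_le: "set ss \<subseteq> X \<Longrightarrow> word_length X (word_prod ss) \<le> length ss"
  unfolding word_length_def word_prod_def by (rule Least_le) blast

lemma reduced_word:
  assumes "\<And>s. s \<in> X \<Longrightarrow> linear s \<and> s \<circ> s = id" "w \<in> gen_subgroup X"
  obtains ss where "set ss \<subseteq> X" "word_prod ss = w" "length ss = word_length X w"
proof -
  have "\<exists>n ss. length ss = n \<and> set ss \<subseteq> X \<and> word_prod ss = w"
    using gen_subgroup_words[OF assms(1)] assms(2) by fastforce
  then have "\<exists>ss. length ss = word_length X w \<and> set ss \<subseteq> X \<and> word_prod ss = w"
    unfolding word_length_def word_prod_def by (rule LeastI_ex)
  then show thesis using that by blast
qed


section \<open>The chamber of a Vinberg system\<close>

text \<open>Here \<open>f\<close> collects the values of finitely many functionals at a point and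
  \<open>g\<close> their values in a direction: a small move in that direction keeps positive values
  positive and makes the zeros positive.\<close>

lemma finite_positive_perturbation:
  fixes f g :: "'b \<Rightarrow> real"
  assumes "finite T" "\<And>t. t \<in> T \<Longrightarrow> 0 < f t \<or> f t = 0 \<and> 0 < g t"
  shows "\<exists>\<epsilon>>0. \<forall>t\<in>T. 0 < f t + \<epsilon> * g t"
proof -
  have "eventually (\<lambda>e. 0 < f t + e * g t) (at_right 0)" if "t \<in> T" for t
  proof (cases "0 < f t")
    case True
    have "((\<lambda>e. f t + e * g t) \<longlongrightarrow> f t + 0 * g t) (at_right 0)" by (intro tendsto_intros)
    then show ?thesis using True by (auto dest: order_tendstoD)
  next
    case False
    then have "f t = 0" "0 < g t" using assms(2)[OF that] by auto
    then show ?thesis by (auto simp: eventually_at_right_less eventually_at_filter intro: always_eventually)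
  qed
  then have "eventually (\<lambda>e. \<forall>t\<in>T. 0 < f t + e * g t) (at_right (0::real))"
    using assms(1) by (simp add: eventually_ball_finite)
  then have "eventually (\<lambda>e. (\<forall>t\<in>T. 0 < f t + e * g t) \<and> 0 < e) (at_right (0::real))"
    by (intro eventually_conj) (simp_all add: eventually_at_right_less)
  then show ?thesis using eventually_happens trivial_limit_at_right_real by blast
qed

locale vinberg =
  fixes K :: "'a::euclidean_space set" and S :: "('a \<Rightarrow> 'a) set"
  assumes vinberg_system: "vinberg_system K S"
begin

lemma polyhedron_K: "polyhedron K" and convex_cone_K: "convex_cone K"
  and interior_K_nonempty: "interior K \<noteq> {}"
  and reflection_S: "s \<in> S \<Longrightarrow> reflection s"
  and bij_walls: "bij_betw fixed_space S (walls K)"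
  and disjoint_id: "w \<in> gen_subgroup S \<Longrightarrow> w \<noteq> id \<Longrightarrow> w ` interior K \<inter> interior K = {}"
  using vinberg_system by (auto simp: vinberg_system_def)

lemma zero_in_K: "0 \<in> K"
  using convex_cone_K convex_cone_contains_0 by blast

lemma finite_S: "finite S"
proof -
  have "finite (walls K)"
    unfolding walls_def by (intro finite_imageI finite_polyhedron_facets polyhedron_K)
  then show ?thesis using bij_betw_finite[OF bij_walls] by simp
qed

lemma S_involution: "s \<in> S \<Longrightarrow> linear s \<and> s \<circ> s = id"
  using reflection_S[of s] unfolding reflection_def by blast

text \<open>A facet is exposed by a supporting hyperplane, which passes through the origin because
  \<open>K\<close> is a cone. By dimension, the facet spans all of it.\<close>

lemma facet_zero:
  assumes F: "F facet_of K"
  obtains a where "a \<noteq> 0" "K \<subseteq> {x. 0 \<le> a \<bullet> x}" "F = K \<inter> {x. a \<bullet> x = 0}" "span F = {x. a \<bullet> x = 0}"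
proof -
  have "F exposed_face_of K"
    using F facet_of_imp_face_of exposed_face_of_polyhedron[OF polyhedron_K] by blast
  then obtain a b where ab: "K \<subseteq> {x. a \<bullet> x \<le> b}" "F = K \<inter> {x. a \<bullet> x = b}"
    by (auto simp: exposed_face_of_def)
  have "F \<noteq> {}" using F by (simp add: facet_of_def)
  then obtain x where x: "x \<in> K" "a \<bullet> x = b" using ab by auto
  \<comment> \<open>A positive \<open>b\<close> would be exceeded at \<open>2 x\<close>; a negative
    one is excluded by the origin.\<close>
  have "2 *\<^sub>R x \<in> K" using convex_cone_K x(1) by (simp add: convex_cone_def conic_def)
  then have "b \<le> 0" using ab(1) x by auto
  moreover have "0 \<le> b" using zero_in_K ab(1) by auto
  ultimately have b: "b = 0" by simp
  have dK: "aff_dim K = int DIM('a)"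
    using interior_K_nonempty aff_dim_nonempty_interior by blast
  have "a \<noteq> 0"
  proof
    assume "a = 0"
    then have "F = K" using ab b by auto
    then show False using F by (simp add: facet_of_def)
  qed
  have "0 \<in> F" using zero_in_K ab b by auto
  then have "aff_dim F = int (dim F)" by (intro aff_dim_zero hull_inc)
  moreover have "aff_dim F = int DIM('a) - 1" using F dK by (simp add: facet_of_def)
  ultimately have "int (dim F) = int DIM('a) - 1" by simp
  then have "dim (span F) = DIM('a) - 1" by simp
  moreover have "span F \<subseteq> {x. a \<bullet> x = 0}"
    using ab b by (intro span_minimal) (auto simp: subspace_hyperplane)
  ultimately have "span F = {x. a \<bullet> x = 0}"
    using \<open>a \<noteq> 0\<close> by (intro subspace_dim_equal) (auto simp: subspace_hyperplane dim_hyperplane)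
  \<comment> \<open>The exposing functional is bounded above on \<open>K\<close>; its negative is
    the inward normal.\<close>
  then show thesis
    using that[of "- a"] \<open>a \<noteq> 0\<close> ab b by auto
qed

lemma wall_normal:
  assumes "s \<in> S"
  shows "\<exists>a. a \<noteq> 0 \<and> K \<subseteq> {x. 0 \<le> a \<bullet> x} \<and> fixed_space s = {x. a \<bullet> x = 0}
    \<and> span (K \<inter> fixed_space s) = fixed_space s \<and> (\<forall>x. a \<bullet> s x = - (a \<bullet> x))"
proof -
  have "fixed_space s \<in> walls K" using bij_walls assms by (auto simp: bij_betw_def)
  then obtain F where F: "F facet_of K" "fixed_space s = span F" by (auto simp: walls_def)
  obtain a where a: "a \<noteq> 0" "K \<subseteq> {x. 0 \<le> a \<bullet> x}" "F = K \<inter> {x. a \<bullet> x = 0}"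
    "span F = {x. a \<bullet> x = 0}"
    by (rule facet_zero[OF F(1)])
  have "a \<bullet> s x = - (a \<bullet> x)" for x
  proof -
    have "s (x + s x) = x + s x"
      using S_involution[OF assms] by (simp add: linear_add pointfree_idE)
    then have "x + s x \<in> {x. a \<bullet> x = 0}" using F(2) a(4) by (auto simp: fixed_space_def)
    then show ?thesis by (simp add: inner_add_right)
  qed
  then show ?thesis using a F by metis
qed

text \<open>The inward normal of the wall of \<open>s\<close>, unique up to a positive
  factor.\<close>

definition nrm :: "('a \<Rightarrow> 'a) \<Rightarrow> 'a" where
  "nrm s = (SOME a. a \<noteq> 0 \<and> K \<subseteq> {x. 0 \<le> a \<bullet> x} \<and> fixed_space s = {x. a \<bullet> x = 0}
    \<and> span (K \<inter> fixed_space s) = fixed_space s \<and> (\<forall>x. a \<bullet> s x = - (a \<bullet> x)))"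

lemma nrm:
  assumes "s \<in> S"
  shows nrm_nonzero: "nrm s \<noteq> 0"
    and nrm_K: "x \<in> K \<Longrightarrow> 0 \<le> nrm s \<bullet> x"
    and fixed_space_nrm: "fixed_space s = {x. nrm s \<bullet> x = 0}"
    and span_wall: "span (K \<inter> fixed_space s) = fixed_space s"
    and nrm_reflect: "nrm s \<bullet> s y = - (nrm s \<bullet> y)"
  using someI_ex[OF wall_normal[OF assms]] unfolding nrm_def[symmetric] by auto

lemma fixed_iff_nrm: "s \<in> S \<Longrightarrow> s x = x \<longleftrightarrow> nrm s \<bullet> x = 0"
  using fixed_space_nrm[of s] by (auto simp: fixed_space_def)

lemma interior_K_pos:
  assumes "s \<in> S" "x \<in> interior K"
  shows "0 < nrm s \<bullet> x"
proof -
  have "x \<in> interior {x. 0 \<le> nrm s \<bullet> x}"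
    using assms nrm_K[OF assms(1)] interior_mono[of K "{x. 0 \<le> nrm s \<bullet> x}"] by auto
  then show ?thesis using nrm_nonzero[OF assms(1)] by (simp add: interior_halfspace_ge)
qed

text \<open>The relative boundary of a polyhedron is the union of its facets, so every boundary
  point of \<open>K\<close> lies on some wall. If \<open>x\<close> satisfied the weak inequalities
  outside \<open>K\<close>, the segment from an interior point to \<open>x\<close> would meet a wall
  before \<open>x\<close>, where that normal is still positive.\<close>

lemma interior_K_eq: "interior K = {x. \<forall>s\<in>S. 0 < nrm s \<bullet> x}"
  and mem_K_iff: "y \<in> K \<longleftrightarrow> (\<forall>s\<in>S. 0 \<le> nrm s \<bullet> y)"
proof -
  obtain c where c: "c \<in> interior K" using interior_K_nonempty by blast
  have "rel_interior K = interior K"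
    using interior_K_nonempty by (rule rel_interior_nonempty_interior)
  then have frontier: "\<exists>s\<in>S. nrm s \<bullet> z = 0" if z: "z \<in> K" "z \<notin> interior K" for z
  proof -
    have "z \<in> \<Union>{F. F facet_of K}"
      using z rel_boundary_of_polyhedron[OF polyhedron_K] \<open>rel_interior K = interior K\<close> by auto
    then obtain F where F: "F facet_of K" "z \<in> F" by blast
    then have "span F \<in> fixed_space ` S" using bij_walls by (auto simp: bij_betw_def walls_def)
    then obtain s where "s \<in> S" "span F = fixed_space s" by auto
    then show ?thesis using F fixed_space_nrm[of s] span_base[of z F] by auto
  qed
  have K: "K = {x. \<forall>s\<in>S. 0 \<le> nrm s \<bullet> x}"
  proof (intro equalityI subsetI)
    fix x assume x: "x \<in> {x. \<forall>s\<in>S. 0 \<le> nrm s \<bullet> x}"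
    show "x \<in> K"
    proof (rule ccontr)
      assume "x \<notin> K"
      have "closed_segment c x \<inter> frontier K \<noteq> {}"
        using c \<open>x \<notin> K\<close> interior_subset
        by (intro connected_Int_frontier) (auto intro: ends_in_segment)
      then obtain z where z: "z \<in> closed_segment c x" "z \<in> frontier K" by auto
      then have "z \<in> K" "z \<notin> interior K"
        using polyhedron_imp_closed[OF polyhedron_K] by (auto simp: frontier_def)
      then obtain s where s: "s \<in> S" "nrm s \<bullet> z = 0" using frontier by blast
      obtain u where u: "0 \<le> u" "u \<le> 1" "z = (1 - u) *\<^sub>R c + u *\<^sub>R x"
        using z(1) by (auto simp: closed_segment_def)
      have "(1 - u) * (nrm s \<bullet> c) + u * (nrm s \<bullet> x) = 0" using s(2) u(3) by (simp add: inner_add_right)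
      moreover have "0 < nrm s \<bullet> c" "0 \<le> nrm s \<bullet> x" using interior_K_pos[OF s(1) c] x s(1) by auto
      ultimately have "u = 1" using u(1,2)
        by (smt (verit) mult_nonneg_nonneg mult_pos_pos)
      then show False using u(3) \<open>z \<in> K\<close> \<open>x \<notin> K\<close> by simp
    qed
  qed (use nrm_K in auto)
  show "y \<in> K \<longleftrightarrow> (\<forall>s\<in>S. 0 \<le> nrm s \<bullet> y)" by (subst K) simp
  show "interior K = {x. \<forall>s\<in>S. 0 < nrm s \<bullet> x}"
  proof (intro equalityI subsetI)
    fix x assume x: "x \<in> {x. \<forall>s\<in>S. 0 < nrm s \<bullet> x}"
    then have "x \<in> K" using K by fastforce
    then show "x \<in> interior K" using frontier x by fastforce
  qed (use interior_K_pos in auto)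
qed

definition c0 :: 'a where "c0 = (SOME c. c \<in> interior K)"

lemma c0: "c0 \<in> interior K"
  using interior_K_nonempty unfolding c0_def by (simp add: some_in_eq)

lemma c0_pos: "s \<in> S \<Longrightarrow> 0 < nrm s \<bullet> c0"
  using c0 interior_K_pos by blast

lemma c0_in_K: "c0 \<in> K"
  using c0 interior_subset by blast

lemma convex_K: "convex K"
  using convex_cone_K by (simp add: convex_cone_def)

lemma closure_interior_K: "closure (interior K) = K"
  using convex_closure_interior[OF convex_K interior_K_nonempty] polyhedron_imp_closed[OF polyhedron_K]
  by simp

lemma inj_on_fixed_space: "inj_on fixed_space S"
  using bij_walls by (simp add: bij_betw_def)

text \<open>An inner point of the facet on \<open>H_s\<close>. The facet spans \<open>H_s\<close>,
  so it lies in no other wall; adding up one witness for each other wall makes all the other normals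
  positive at once.\<close>

lemma wall_point:
  assumes "s \<in> S"
  obtains p where "nrm s \<bullet> p = 0" "\<And>t. t \<in> S \<Longrightarrow> t \<noteq> s \<Longrightarrow> 0 < nrm t \<bullet> p"
proof -
  have "\<exists>x. x \<in> K \<inter> fixed_space s \<and> 0 < nrm t \<bullet> x" if t: "t \<in> S" "t \<noteq> s" for t
  proof (rule ccontr)
    assume n: "\<nexists>x. x \<in> K \<inter> fixed_space s \<and> 0 < nrm t \<bullet> x"
    have "K \<inter> fixed_space s \<subseteq> fixed_space t"
      using n nrm_K[OF t(1)] fixed_space_nrm[OF t(1)] by force
    then have "fixed_space s \<subseteq> fixed_space t"
      using span_wall[OF assms] span_minimal[of "K \<inter> fixed_space s" "fixed_space t"]
        reflection_hyperplane[OF reflection_S[OF t(1)]] linear_hyperplane_subspace by auto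
    then have "fixed_space s = fixed_space t"
      using reflection_hyperplane reflection_S assms t(1) linear_hyperplane_subset_eq by blast
    then show False using inj_on_fixed_space assms t by (auto simp: inj_on_def)
  qed
  then obtain x where x: "\<And>t. t \<in> S \<Longrightarrow> t \<noteq> s \<Longrightarrow> x t \<in> K \<inter> fixed_space s \<and> 0 < nrm t \<bullet> x t"
    by metis
  let ?p = "\<Sum>t\<in>S - {s}. x t"
  show thesis
  proof (rule that)
    show "nrm s \<bullet> ?p = 0"
      using x fixed_space_nrm[OF assms] by (auto simp: inner_sum_right intro!: sum.neutral)
    fix t assume t: "t \<in> S" "t \<noteq> s"
    have "0 \<le> nrm t \<bullet> x u" if "u \<in> S - {s}" for u
      using nrm_K[OF t(1)] x that by auto
    then show "0 < nrm t \<bullet> ?p"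
      unfolding inner_sum_right using t x finite_S
      by (intro sum_pos2[of _ t]) auto
  qed
qed

section \<open>The group and its parabolic subgroups\<close>

abbreviation "W \<equiv> gen_subgroup S"

lemma gen_words: "X \<subseteq> S \<Longrightarrow> gen_subgroup X = {word_prod ss | ss. set ss \<subseteq> X}"
  using S_involution by (intro gen_subgroup_words) blast

lemma word_in_gen: "X \<subseteq> S \<Longrightarrow> set ss \<subseteq> X \<Longrightarrow> word_prod ss \<in> gen_subgroup X"
  using gen_words by blast

lemma gen_id: "X \<subseteq> S \<Longrightarrow> id \<in> gen_subgroup X"
  using word_in_gen[of X "[]"] by simp

lemma gen_incl: "X \<subseteq> S \<Longrightarrow> s \<in> X \<Longrightarrow> s \<in> gen_subgroup X"
  using word_in_gen[of X "[s]"] by simp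

lemma gen_comp:
  assumes "X \<subseteq> S" "u \<in> gen_subgroup X" "v \<in> gen_subgroup X"
  shows "u \<circ> v \<in> gen_subgroup X"
proof -
  obtain xs ys where "u = word_prod xs" "v = word_prod ys" "set xs \<subseteq> X" "set ys \<subseteq> X"
    using assms gen_words by auto
  then show ?thesis using word_in_gen[OF assms(1), of "xs @ ys"] by (simp add: word_prod_append)
qed

lemma gen_mono: "X \<subseteq> Y \<Longrightarrow> Y \<subseteq> S \<Longrightarrow> gen_subgroup X \<subseteq> gen_subgroup Y"
  using gen_words[of X] gen_words[of Y] by fastforce

lemma gen_W: "X \<subseteq> S \<Longrightarrow> u \<in> gen_subgroup X \<Longrightarrow> u \<in> W"
  using gen_mono by blast

lemma S_S:
  assumes "s \<in> S"
  shows "s (s x) = x"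
proof -
  have "s \<circ> s = id" using S_involution[OF assms] by (rule conjunct2)
  then show ?thesis by (rule pointfree_idE)
qed

lemma word_prod_rev_apply: "set ss \<subseteq> S \<Longrightarrow> word_prod ss (word_prod (rev ss) x) = x"
  by (induction ss arbitrary: x) (simp_all add: word_prod_append S_S)

lemma word_prod_rev: "set ss \<subseteq> S \<Longrightarrow> word_prod ss \<circ> word_prod (rev ss) = id"
  by (rule ext) (simp add: word_prod_rev_apply)

lemma inv_map_word: "set ss \<subseteq> S \<Longrightarrow> inv_map (word_prod ss) = word_prod (rev ss)"
  using word_prod_rev[of ss] word_prod_rev[of "rev ss"] by (intro inv_unique_comp) auto

lemma gen_inv:
  assumes "X \<subseteq> S" "u \<in> gen_subgroup X"
  shows "inv_map u \<in> gen_subgroup X"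
proof -
  obtain xs where "u = word_prod xs" "set xs \<subseteq> X" using assms gen_words by auto
  then show ?thesis using word_in_gen[OF assms(1), of "rev xs"] inv_map_word[of xs] assms(1) by auto
qed

lemma W_linear: "u \<in> W \<Longrightarrow> linear u" and W_bij: "u \<in> W \<Longrightarrow> bij u"
  using gen_subgroup_linear_bij[of u S] S_involution by (auto intro: o_bij)

lemma W_inv: "u \<in> W \<Longrightarrow> inv_map u (u x) = x" "u \<in> W \<Longrightarrow> u (inv_map u x) = x"
  using W_bij[of u] by (simp_all add: bij_is_inj bij_is_surj surj_f_inv_f)

lemma W_inv_comp: "u \<in> W \<Longrightarrow> inv_map u \<circ> u = id" "u \<in> W \<Longrightarrow> u \<circ> inv_map u = id"
  by (auto simp: W_inv)

lemmas W_id = gen_id[OF order_refl] and W_comp = gen_comp[OF order_refl]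
  and W_inverse = gen_inv[OF order_refl] and S_W = gen_incl[OF order_refl]

lemma conj_W:
  assumes "u \<in> W" "r \<in> W" "reflection r"
  shows "u \<circ> r \<circ> inv_map u \<in> W" "reflection (u \<circ> r \<circ> inv_map u)"
    "fixed_space (u \<circ> r \<circ> inv_map u) = u ` fixed_space r"
  using reflection_conj[OF assms(3) W_linear[OF assms(1)] W_bij[OF assms(1)]]
    W_comp[OF W_comp[OF assms(1,2)] W_inverse[OF assms(1)]] by simp_all

lemma mem_image_W: "u \<in> W \<Longrightarrow> x \<in> u ` Z \<longleftrightarrow> inv_map u x \<in> Z"
  using W_inv(2)[of u x] by (auto simp: W_inv(1) intro: rev_image_eqI[where x = "inv_map u x"])

lemma W_separates: "u \<in> W \<Longrightarrow> separates (u ` H) (u x) (u y) \<longleftrightarrow> separates H x y"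
  by (simp add: separates_image W_linear W_bij)

lemma inv_map_image: "u \<in> W \<Longrightarrow> inv_map u ` u ` Z = Z" "u \<in> W \<Longrightarrow> u ` inv_map u ` Z = Z"
  by (auto simp: W_inv image_image)


section \<open>Sides of chambers and the exchange condition\<close>

text \<open>If \<open>w x\<close> were fixed by \<open>r\<close>, the conjugate of \<open>r\<close>
  by \<open>w\<close> would fix a point of the open chamber, hence be the identity.\<close>

lemma not_on_hyperplane:
  assumes r: "r \<in> W" "reflection r" and w: "w \<in> W" and x: "x \<in> interior K"
  shows "w x \<notin> fixed_space r"
proof
  assume "w x \<in> fixed_space r"
  then have rx: "r (w x) = w x" by (simp add: fixed_space_def)
  define g where "g = inv_map w \<circ> r \<circ> w"
  have g: "g \<in> W" using r w by (simp add: g_def W_comp W_inverse)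
  have "g x = x" using rx w by (simp add: g_def W_inv)
  then have "g ` interior K \<inter> interior K \<noteq> {}" using x by force
  then have "g = id" using g disjoint_id by blast
  then have "w \<circ> g \<circ> inv_map w = id" using w by (simp add: W_inv_comp)
  moreover have "w \<circ> g \<circ> inv_map w = r" using w by (auto simp: g_def W_inv)
  ultimately show False using r(2) by (simp add: reflection_def)
qed

text \<open>The segment from \<open>c0\<close> to \<open>y\<close> stays in the open chamber until
  it reaches \<open>y\<close>. Translated by \<open>w\<close>, it can meet the hyperplane only at
  its end, where separation is excluded.\<close>

lemma same_side:
  assumes r: "r \<in> W" "reflection r" and w: "w \<in> W" and y: "y \<in> K"
  shows "\<not> separates (fixed_space r) (w c0) (w y)"
proof
  assume s: "separates (fixed_space r) (w c0) (w y)"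
  then obtain z where z: "z \<in> closed_segment c0 y" "w z \<in> fixed_space r"
    unfolding separates_def closed_segment_linear_image[OF W_linear[OF w]] by blast
  then obtain u where u: "0 \<le> u" "u \<le> 1" "z = (1 - u) *\<^sub>R c0 + u *\<^sub>R y"
    by (auto simp: closed_segment_def)
  have "u \<noteq> 1" using s z u by (auto simp: separates_def)
  then have "0 < nrm t \<bullet> z" if "t \<in> S" for t
    using u nrm_K[OF that y] c0_pos[OF that] by (simp add: inner_add_right add_pos_nonneg)
  then have "z \<in> interior K" by (simp add: interior_K_eq)
  then show False using not_on_hyperplane[OF r w] z(2) by blast
qed

lemma same_side_sign:
  assumes "r \<in> W" "reflection r" "w \<in> W" "y \<in> K" "fixed_space r = {x. b \<bullet> x = 0}" "0 < b \<bullet> w c0"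
  shows "0 \<le> b \<bullet> w y"
  using same_side[OF assms(1-4)] assms(5,6) by (simp add: separates_iff mult_less_0_iff not_less)

lemma nrm_chamber_nonzero: "s \<in> S \<Longrightarrow> w \<in> W \<Longrightarrow> nrm s \<bullet> w c0 \<noteq> 0"
  using not_on_hyperplane[OF S_W reflection_S _ c0] fixed_space_nrm by auto

lemma separates_wall_iff: "s \<in> S \<Longrightarrow> separates (fixed_space s) c0 x \<longleftrightarrow> nrm s \<bullet> x < 0"
  using c0_pos[of s] by (simp add: fixed_space_nrm separates_iff mult_less_0_iff)

text \<open>A hyperplane between \<open>C\<^sub>0\<close> and \<open>s C\<^sub>0\<close> contains the facet \<open>K \<inter> H\<^sub>s\<close> common to both, so it
  is \<open>H\<^sub>s\<close>; then \<open>r C\<^sub>0\<close> and \<open>s C\<^sub>0\<close> overlap near an inner point of that facet.\<close>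

lemma adjacent_reflection_eq:
  assumes r: "r \<in> W" "reflection r" and s: "s \<in> S" and sep: "separates (fixed_space r) c0 (s c0)"
  shows "r = s"
proof -
  obtain b where b: "fixed_space r = {x. b \<bullet> x = 0}" "0 < b \<bullet> c0" "b \<bullet> s c0 < 0"
  proof (rule reflection_normal[OF r(2)])
    fix a assume a: "fixed_space r = {x. a \<bullet> x = 0}"
    have "(a \<bullet> c0) * (a \<bullet> s c0) < 0" using sep by (simp add: a separates_iff)
    then show thesis using that[of a] that[of "- a"] a by (auto simp: mult_less_0_iff)
  qed
  have "K \<inter> fixed_space s \<subseteq> fixed_space r"
  proof
    fix x assume x: "x \<in> K \<inter> fixed_space s"
    have "0 \<le> b \<bullet> id x"
      using same_side_sign[OF r W_id, of x b] x b by auto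
    moreover have "0 \<le> (- b) \<bullet> s x"
      using same_side_sign[OF r S_W[OF s], of x "- b"] x b by auto
    ultimately show "x \<in> fixed_space r" using x b(1) by (simp add: fixed_space_def)
  qed
  then have "span (K \<inter> fixed_space s) \<subseteq> fixed_space r"
    using linear_hyperplane_subspace[OF reflection_hyperplane[OF r(2)]] by (rule span_minimal)
  then have Hrs: "fixed_space r = {x. nrm s \<bullet> x = 0}"
    using linear_hyperplane_subset_eq[of "fixed_space s" "fixed_space r"] r(2) s
    unfolding span_wall[OF s] by (simp add: reflection_hyperplane reflection_S flip: fixed_space_nrm)
  have rr: "r (r x) = x" and lr: "linear r" for x
    using r(2) by (auto simp: reflection_def pointfree_idE)
  have "c0 + r c0 \<in> fixed_space r" using rr by (simp add: fixed_space_def linear_add[OF lr])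
  then have "nrm s \<bullet> r c0 = - (nrm s \<bullet> c0)" by (simp add: Hrs inner_add_right)
  then have pos: "0 < nrm s \<bullet> s (r c0)" using c0_pos[OF s] by (simp add: nrm_reflect[OF s])
  \<comment> \<open>Both \<open>r\<close> and \<open>s\<close> fix \<open>p\<close>, so
    \<open>s \<circ> r\<close> sends \<open>p + d c0\<close> to \<open>p + d s (r c0)\<close>. For
    small \<open>d\<close> both points lie in the open chamber, which forces
    \<open>s \<circ> r = id\<close>.\<close>
  obtain p where p: "nrm s \<bullet> p = 0" "\<And>t. t \<in> S \<Longrightarrow> t \<noteq> s \<Longrightarrow> 0 < nrm t \<bullet> p"
    using wall_point[OF s] by blast
  have "0 < nrm t \<bullet> p \<or> nrm t \<bullet> p = 0 \<and> 0 < nrm t \<bullet> s (r c0)" if "t \<in> S" for t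
    using p pos that by (cases "t = s") auto
  then have "\<exists>d>0. \<forall>t\<in>S. 0 < nrm t \<bullet> p + d * (nrm t \<bullet> s (r c0))"
    by (intro finite_positive_perturbation finite_S)
  then obtain d where d: "0 < d" "\<And>t. t \<in> S \<Longrightarrow> 0 < nrm t \<bullet> p + d * (nrm t \<bullet> s (r c0))"
    by blast
  define y where "y = p + d *\<^sub>R c0"
  have p0: "0 \<le> nrm t \<bullet> p" if "t \<in> S" for t
    using p that by (cases "t = s") (auto simp: less_imp_le)
  have "y \<in> interior K"
    using p0 d(1) c0_pos by (auto simp: interior_K_eq y_def inner_add_right intro!: add_nonneg_pos)
  moreover have "r p = p" using p(1) Hrs by (auto simp: fixed_space_def)
  then have "s (r y) = p + d *\<^sub>R s (r c0)"
    using S_involution[OF s] p(1) s by (simp add: y_def linear_add linear_cmul lr fixed_iff_nrm)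
  then have "s (r y) \<in> interior K" using d(2) by (simp add: interior_K_eq inner_add_right)
  ultimately have "(s \<circ> r) ` interior K \<inter> interior K \<noteq> {}" by force
  then have "s \<circ> r = id" using disjoint_id W_comp[OF S_W[OF s] r(1)] by blast
  then have "s \<circ> (s \<circ> r) = s" by simp
  then show ?thesis using S_involution[OF s] by (simp add: o_assoc)
qed

text \<open>The prefixes of the word form a gallery from the fundamental chamber, hence the
  induction from the right: appending \<open>s\<close> moves from \<open>u\<close> to the adjacent
  \<open>u \<circ> s\<close>. If the hyperplane is crossed there, pulling back by \<open>u\<close>
  and applying \<open>adjacent_reflection_eq\<close> turns \<open>r\<close> into
  \<open>s\<close>.\<close>

lemma gallery_crossing:
  assumes r: "r \<in> W" "reflection r"
  shows "set ss \<subseteq> S \<Longrightarrow> separates (fixed_space r) c0 (word_prod ss c0) \<Longrightarrow>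
    \<exists>xs s ys. ss = xs @ s # ys \<and> r \<circ> word_prod xs = word_prod xs \<circ> s"
proof (induction ss rule: rev_induct)
  case Nil
  then show ?case
    using same_side[OF r W_id c0_in_K] by simp
next
  case (snoc s ss)
  let ?u = "word_prod ss"
  have u: "?u \<in> W" and s: "s \<in> S" using snoc.prems word_in_gen[of S ss] by auto
  show ?case
  proof (cases "separates (fixed_space r) c0 (?u c0)")
    case True
    then obtain xs t ys where "ss = xs @ t # ys" "r \<circ> word_prod xs = word_prod xs \<circ> t"
      using snoc.IH[OF _ True] snoc.prems(1) by fastforce
    then show ?thesis by (intro exI[of _ xs] exI[of _ t] exI[of _ "ys @ [s]"]) simp
  next
    case False
    have "c0 \<notin> fixed_space r" "?u c0 \<notin> fixed_space r" "?u (s c0) \<notin> fixed_space r"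
      using not_on_hyperplane[OF r _ c0, of id] not_on_hyperplane[OF r u c0]
        not_on_hyperplane[OF r W_comp[OF u S_W[OF s]] c0] W_id by auto
    moreover have "separates (fixed_space r) c0 (?u (s c0))"
      using snoc.prems(2) by (simp add: word_prod_append)
    ultimately have sep: "separates (fixed_space r) (?u c0) (?u (s c0))"
      using False separates_trans[OF reflection_hyperplane[OF r(2)]] by blast
    define q where "q = inv_map ?u \<circ> r \<circ> inv_map (inv_map ?u)"
    have q: "q \<in> W" "reflection q" "fixed_space q = inv_map ?u ` fixed_space r"
      using conj_W[OF W_inverse[OF u] r] by (simp_all add: q_def)
    have ii: "inv_map (inv_map ?u) = ?u" using W_bij[OF u] by (rule inv_inv_eq)
    have "separates (fixed_space q) (inv_map ?u (?u c0)) (inv_map ?u (?u (s c0)))"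
      unfolding q(3) W_separates[OF W_inverse[OF u]] by (rule sep)
    then have "q = s" using adjacent_reflection_eq[OF q(1,2) s] by (simp add: W_inv[OF u])
    then have "?u \<circ> q = ?u \<circ> s" by simp
    then have "r \<circ> ?u = ?u \<circ> s" unfolding q_def ii by (simp add: o_assoc W_inv_comp[OF u])
    then show ?thesis by (intro exI[of _ ss] exI[of _ s] exI[of _ "[]"]) simp
  qed
qed

text \<open>A crossing at the letter \<open>s\<close> after the prefix \<open>xs\<close> exhibits
  \<open>r\<close> as the conjugate of \<open>s\<close> by that prefix, so multiplying by
  \<open>r\<close> deletes this letter from a reduced word. Lengths and words are over
  \<open>X\<close>, which also gives membership in the parabolic subgroup.\<close>

lemma strong_exchange:
  assumes X: "X \<subseteq> S" and w: "w \<in> gen_subgroup X" and r: "r \<in> W" "reflection r"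
    and sep: "separates (fixed_space r) c0 (w c0)"
  shows "r \<in> gen_subgroup X" "word_length X (r \<circ> w) < word_length X w"
proof -
  obtain ss where ss: "set ss \<subseteq> X" "word_prod ss = w" "length ss = word_length X w"
    using reduced_word[of X w] S_involution X w by (metis subsetD)
  obtain xs s ys where xs: "ss = xs @ s # ys" "r \<circ> word_prod xs = word_prod xs \<circ> s"
    using gallery_crossing[OF r, of ss] ss(1,2) sep X by blast
  have s: "s \<in> S" "set xs \<subseteq> S" using ss xs X by auto
  have rx: "r (word_prod xs x) = word_prod xs (s x)" for x
    using fun_cong[OF xs(2), of x] by simp
  have "r = word_prod (xs @ [s] @ rev xs)"
  proof
    fix x show "r x = word_prod (xs @ [s] @ rev xs) x"
      using rx[of "word_prod (rev xs) x"] by (simp add: word_prod_append word_prod_rev_apply[OF s(2)])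
  qed
  then show "r \<in> gen_subgroup X"
    using word_in_gen[OF X, of "xs @ [s] @ rev xs"] ss(1) xs(1) by auto
  have "r \<circ> w = word_prod (xs @ ys)"
    by (rule ext) (simp add: xs(1) word_prod_append rx S_S[OF s(1)] flip: ss(2))
  then show "word_length X (r \<circ> w) < word_length X w"
    using word_length_le[of "xs @ ys" X] ss xs(1) by simp
qed

text \<open>Multiplying by \<open>r\<close> changes the side, so strong exchange applies to
  \<open>r \<circ> w\<close> and leads back to \<open>w\<close>.\<close>

lemma not_separated_length:
  assumes X: "X \<subseteq> S" and w: "w \<in> gen_subgroup X" and r: "r \<in> gen_subgroup X" "reflection r"
    and sep: "\<not> separates (fixed_space r) c0 (w c0)"
  shows "word_length X w < word_length X (r \<circ> w)"
proof -
  have rW: "r \<in> W" and wW: "w \<in> W" using X r w gen_W by auto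
  have rr: "r \<circ> r = id" using r(2) by (simp add: reflection_def)
  have n: "c0 \<notin> fixed_space r" "w c0 \<notin> fixed_space r" "r (w c0) \<notin> fixed_space r"
    using not_on_hyperplane[OF rW r(2) _ c0, of id] not_on_hyperplane[OF rW r(2) wW c0]
      not_on_hyperplane[OF rW r(2) W_comp[OF rW wW] c0] W_id by auto
  then have "separates (fixed_space r) c0 ((r \<circ> w) c0)"
    using sep reflection_separates[OF r(2), of "w c0"]
      separates_trans[OF reflection_hyperplane[OF r(2)], of c0 "w c0" "r (w c0)"] by simp
  then have "word_length X (r \<circ> (r \<circ> w)) < word_length X (r \<circ> w)"
    using strong_exchange[OF X gen_comp[OF X r(1) w] rW r(2)] by blast
  then show ?thesis by (simp add: o_assoc rr)
qed

text \<open>The first letter of a reduced word over \<open>X\<close> works: removing it shortens the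
  word, which is impossible without separation.\<close>

lemma exists_separating_generator:
  assumes X: "X \<subseteq> S" and w: "w \<in> gen_subgroup X" "w \<noteq> id"
  obtains s where "s \<in> X" "separates (fixed_space s) c0 (w c0)" "s \<circ> w \<in> gen_subgroup X"
    "word_length X (s \<circ> w) < word_length X w"
proof -
  obtain ss where ss: "set ss \<subseteq> X" "word_prod ss = w" "length ss = word_length X w"
    using reduced_word[of X w] S_involution X w by (metis subsetD)
  obtain s ys where sy: "ss = s # ys" using ss(2) w(2) by (cases ss) auto
  have s: "s \<in> X" "s \<in> S" using ss sy X by auto
  have sw: "s \<circ> w = word_prod ys"
    using ss(2) sy by (auto simp: S_S[OF s(2)])
  then have l: "word_length X (s \<circ> w) < word_length X w"
    using word_length_le[of ys X] ss sy by simp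
  have "separates (fixed_space s) c0 (w c0)"
    using not_separated_length[OF X w(1) gen_incl[OF X s(1)] reflection_S[OF s(2)]] l by fastforce
  then show thesis using that s(1) l sw word_in_gen[OF X, of ys] ss(1) sy by auto
qed

text \<open>Induction on length. A wall separating the chamber from its translate by
  \<open>w\<close> has \<open>w x\<close> weakly on both sides, since \<open>w x\<close> lies in
  both closed chambers. So its reflection \<open>s\<close> fixes \<open>w x\<close>, and the
  hypothesis applies to the shorter \<open>s \<circ> w\<close>.\<close>

lemma stabilizer:
  assumes x: "x \<in> K"
  shows "w \<in> W \<Longrightarrow> w x \<in> K \<Longrightarrow> w x = x \<and> w \<in> gen_subgroup {s \<in> S. s x = x}"
proof (induction "word_length S w" arbitrary: w rule: less_induct)
  case less
  let ?X = "{s \<in> S. s x = x}"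
  have X: "?X \<subseteq> S" by auto
  show ?case
  proof (cases "w = id")
    case True
    then show ?thesis using gen_id[OF X] by simp
  next
    case False
    obtain s where s: "s \<in> S" "separates (fixed_space s) c0 (w c0)" "s \<circ> w \<in> W"
      "word_length S (s \<circ> w) < word_length S w"
      using exists_separating_generator[OF order_refl less.prems(1) False] by metis
    have "nrm s \<bullet> w c0 < 0" using s by (simp add: separates_wall_iff)
    then have "0 \<le> (- nrm s) \<bullet> w x"
      using same_side_sign[OF S_W[OF s(1)] reflection_S[OF s(1)] less.prems(1) x, of "- nrm s"]
      by (simp add: fixed_space_nrm[OF s(1)])
    then have "nrm s \<bullet> w x = 0" using nrm_K[OF s(1) less.prems(2)] by simp
    then have sw: "s (w x) = w x" by (simp add: fixed_iff_nrm[OF s(1)])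
    then have IH: "(s \<circ> w) x = x" "s \<circ> w \<in> gen_subgroup ?X"
      using less.hyps[OF s(4,3)] less.prems(2) by auto
    then have wx: "w x = x" using sw by simp
    then have "s \<in> ?X" using sw s(1) by simp
    then have "s \<circ> (s \<circ> w) \<in> gen_subgroup ?X" using gen_comp[OF X gen_incl[OF X] IH(2)] by blast
    then show ?thesis using wx S_involution[OF s(1)] by (simp add: o_assoc)
  qed
qed

lemma gen_fixes:
  assumes "X \<subseteq> S" "\<And>s. s \<in> X \<Longrightarrow> s x = x" "w \<in> gen_subgroup X"
  shows "w x = x"
proof -
  obtain ss where ss: "w = word_prod ss" "set ss \<subseteq> X" using assms(1,3) gen_words by auto
  have "set ss \<subseteq> X \<Longrightarrow> word_prod ss x = x" for ss
    by (induction ss) (auto simp: assms(2))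
  then show ?thesis using ss by blast
qed

text \<open>Some generator in \<open>X\<close> separates the chamber from its translate by
  \<open>t\<close>, but only the wall of \<open>t\<close> does so.\<close>

lemma generator_in_parabolic:
  assumes X: "X \<subseteq> S" and t: "t \<in> S" "t \<in> gen_subgroup X"
  shows "t \<in> X"
proof -
  have "t \<noteq> id" using reflection_S[OF t(1)] by (simp add: reflection_def)
  then obtain s where s: "s \<in> X" "separates (fixed_space s) c0 (t c0)"
    using exists_separating_generator[OF X t(2)] by metis
  then have "s = t" using adjacent_reflection_eq[OF S_W reflection_S t(1)] X by blast
  then show ?thesis using s by simp
qed

lemma parabolic_positive:
  assumes X: "X \<subseteq> S" and t: "t \<in> S" "t \<notin> X" and w: "w \<in> gen_subgroup X"
  shows "0 < nrm t \<bullet> w c0"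
proof (rule ccontr)
  assume "\<not> ?thesis"
  then have "nrm t \<bullet> w c0 < 0" using nrm_chamber_nonzero[OF t(1) gen_W[OF X w]] by simp
  then have "t \<in> gen_subgroup X"
    using strong_exchange(1)[OF X w S_W[OF t(1)] reflection_S[OF t(1)]]
    by (simp add: separates_wall_iff[OF t(1)])
  then show False using generator_in_parabolic[OF X t(1)] t(2) by blast
qed

section \<open>The Tits cone\<close>

abbreviation "T \<equiv> \<Union>w\<in>W. w ` K"
abbreviation "I \<equiv> tits_cone K S"
abbreviation "A \<equiv> coxeter_arrangement S"

lemma I_eq: "I = interior T"
  by (simp add: tits_cone_def)

lemma W_image_T:
  assumes "u \<in> W"
  shows "u ` T = T"
proof -
  have sub: "v ` T \<subseteq> T" if v: "v \<in> W" for v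
  proof
    fix x assume "x \<in> v ` T"
    then obtain w y where w: "w \<in> W" "y \<in> K" "x = (v \<circ> w) y" by auto
    then show "x \<in> T" using W_comp[OF v w(1)] by blast
  qed
  have "T = u ` inv_map u ` T" using inv_map_image(2)[OF assms] by simp
  also have "\<dots> \<subseteq> u ` T" using sub[OF W_inverse[OF assms]] by (rule image_mono)
  finally show ?thesis using sub[OF assms] by blast
qed

lemma K_subset_T: "K \<subseteq> T"
  using W_id by (intro subsetI UN_I[of id]) auto

text \<open>Among the walls violated at \<open>y\<close>, the one that the segment from
  \<open>x\<close> meets first. Its crossing point still satisfies all other inequalities.\<close>

lemma first_wall:
  assumes x: "x \<in> K" and y: "y \<notin> K"
  obtains t z where "t \<in> S" "nrm t \<bullet> y < 0" "nrm t \<bullet> z = 0" "z \<in> K" "z \<in> closed_segment x y"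
proof -
  define N where "N = {t \<in> S. nrm t \<bullet> y < 0}"
  \<comment> \<open>The parameter at which the segment crosses the wall of \<open>t\<close>; the
    denominator is positive for \<open>t\<close> in \<open>N\<close>.\<close>
  define \<rho> where "\<rho> t = (nrm t \<bullet> x) / (nrm t \<bullet> x - nrm t \<bullet> y)" for t
  have N: "finite N" "N \<noteq> {}" using finite_S y by (auto simp: N_def mem_K_iff not_le)
  then have "Min (\<rho> ` N) \<in> \<rho> ` N" by (intro Min_in) auto
  then obtain t where t: "t \<in> N" "Min (\<rho> ` N) = \<rho> t" by auto
  have le: "\<rho> t \<le> \<rho> t'" if "t' \<in> N" for t'
    using Min_le[of "\<rho> ` N" "\<rho> t'"] N that t(2) by simp
  have xp: "0 \<le> nrm t' \<bullet> x" if "t' \<in> S" for t' using x that by (simp add: mem_K_iff)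
  have tS: "t \<in> S" "nrm t \<bullet> y < 0" using t by (auto simp: N_def)
  have \<tau>: "0 \<le> \<rho> t" "\<rho> t \<le> 1" using xp[OF tS(1)] tS(2) by (auto simp: \<rho>_def field_simps)
  define z where "z = (1 - \<rho> t) *\<^sub>R x + \<rho> t *\<^sub>R y"
  have nz: "nrm t' \<bullet> z = (1 - \<rho> t) * (nrm t' \<bullet> x) + \<rho> t * (nrm t' \<bullet> y)" for t'
    by (simp add: z_def inner_add_right)
  have "z \<in> closed_segment x y" using \<tau> by (auto simp: z_def closed_segment_def)
  moreover have "nrm t \<bullet> z = 0" using xp[OF tS(1)] tS(2) by (simp add: nz \<rho>_def field_simps)
  moreover have "z \<in> K"
  proof -
    have "0 \<le> nrm t' \<bullet> z" if t': "t' \<in> S" for t'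
    proof (cases "t' \<in> N")
      case True
      then have d: "0 < nrm t' \<bullet> x - nrm t' \<bullet> y" using xp[OF t'] by (simp add: N_def)
      have "\<rho> t * (nrm t' \<bullet> x - nrm t' \<bullet> y) \<le> \<rho> t' * (nrm t' \<bullet> x - nrm t' \<bullet> y)"
        using le[OF True] d by (intro mult_right_mono) auto
      also have "\<dots> = nrm t' \<bullet> x" using d by (simp add: \<rho>_def)
      finally show ?thesis by (simp add: nz algebra_simps)
    next
      case False
      then have "0 \<le> nrm t' \<bullet> y" using t' by (simp add: N_def)
      then show ?thesis using xp[OF t'] \<tau> by (simp add: nz)
    qed
    then show ?thesis by (simp add: mem_K_iff)
  qed
  ultimately show thesis using that tS by blast
qed

text \<open>The segment leaves \<open>K\<close> through a wall \<open>H\<^sub>t\<close> separating \<open>C\<^sub>0\<close> from \<open>w C\<^sub>0\<close>; reflecting the rest of the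
  segment in it shortens \<open>w\<close>.\<close>

lemma segment_subset_T:
  "w \<in> W \<Longrightarrow> x \<in> K \<Longrightarrow> y \<in> K \<Longrightarrow> closed_segment x (w y) \<subseteq> T"
proof (induction "word_length S w" arbitrary: w x rule: less_induct)
  case less
  show ?case
  proof (cases "w y \<in> K")
    case True
    then have "closed_segment x (w y) \<subseteq> K"
      using less.prems convex_K by (simp add: closed_segment_subset)
    then show ?thesis using K_subset_T by blast
  next
    case False
    obtain t z where t: "t \<in> S" "nrm t \<bullet> w y < 0" and z: "nrm t \<bullet> z = 0" "z \<in> K" "z \<in> closed_segment x (w y)"
      by (rule first_wall[OF less.prems(2) False])
    have "\<not> 0 < nrm t \<bullet> w c0"
      using same_side_sign[OF S_W[OF t(1)] reflection_S[OF t(1)] less.prems(1,3) fixed_space_nrm[OF t(1)]]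
        t(2) by linarith
    then have "nrm t \<bullet> w c0 < 0" using nrm_chamber_nonzero[OF t(1) less.prems(1)] by linarith
    then have "word_length S (t \<circ> w) < word_length S w"
      using strong_exchange(2)[OF order_refl less.prems(1) S_W[OF t(1)] reflection_S[OF t(1)]]
      by (simp add: separates_wall_iff[OF t(1)])
    then have "closed_segment z ((t \<circ> w) y) \<subseteq> T"
      using less.hyps[of "t \<circ> w" z] W_comp[OF S_W[OF t(1)] less.prems(1)] z(2) less.prems(3) by blast
    then have "t ` closed_segment z (t (w y)) \<subseteq> T"
      using image_mono[of _ T t] W_image_T[OF S_W[OF t(1)]] by (metis comp_apply)
    moreover have "t z = z" using z(1) by (simp add: fixed_iff_nrm[OF t(1)])
    ultimately have "closed_segment z (w y) \<subseteq> T"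
      using W_linear[OF S_W[OF t(1)]] by (simp add: S_S[OF t(1)] flip: closed_segment_linear_image)
    moreover have "closed_segment x z \<subseteq> T"
      using closed_segment_subset[OF less.prems(2) z(2) convex_K] K_subset_T by blast
    ultimately show ?thesis using Un_closed_segment[OF z(3)] by blast
  qed
qed

lemma convex_T: "convex T"
  unfolding convex_contains_segment
proof (intro ballI)
  fix x y assume "x \<in> T" "y \<in> T"
  then obtain u v x' y' where u: "u \<in> W" "x' \<in> K" "x = u x'" and v: "v \<in> W" "y' \<in> K" "y = v y'" by blast
  have "closed_segment x' ((inv_map u \<circ> v) y') \<subseteq> T"
    using segment_subset_T[OF W_comp[OF W_inverse[OF u(1)] v(1)] u(2) v(2)] .
  then have "u ` closed_segment x' (inv_map u (v y')) \<subseteq> T"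
    using image_mono[of _ T u] W_image_T[OF u(1)] by (metis comp_apply)
  then show "closed_segment x y \<subseteq> T"
    using W_linear[OF u(1)] by (simp add: u(3) v(3) W_inv[OF u(1)] flip: closed_segment_linear_image)
qed

lemma convex_I: "convex I"
  unfolding I_eq by (rule convex_interior[OF convex_T])

lemma W_image_I: "u \<in> W \<Longrightarrow> u ` I = I"
  unfolding I_eq using interior_bijective_linear_image[OF W_linear W_bij, of u T] W_image_T by simp

lemma W_mem_I: "u \<in> W \<Longrightarrow> u x \<in> I \<longleftrightarrow> x \<in> I"
  using W_image_I[of u] inj_image_mem_iff[OF bij_is_inj[OF W_bij], of u x I] by simp


section \<open>Finite parabolic subgroups and faces of the chamber\<close>

abbreviation "walls_at x \<equiv> {s \<in> S. s x = x}"

lemma gen_walls_at_fixes: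
  assumes "w \<in> gen_subgroup (walls_at x)"
  shows "w x = x"
proof (rule gen_fixes[OF _ _ assms])
  show "s x = x" if "s \<in> walls_at x" for s
    using that by blast
qed blast

text \<open>The relatively open face of \<open>K\<close> whose points lie on exactly the walls in
  \<open>X\<close>. It may be empty; for finite parabolic subgroups it is not.\<close>

definition face :: "('a \<Rightarrow> 'a) set \<Rightarrow> 'a set" where
  "face X = {x. \<forall>s\<in>S. (s \<in> X \<longrightarrow> nrm s \<bullet> x = 0) \<and> (s \<notin> X \<longrightarrow> 0 < nrm s \<bullet> x)}"

lemma face_subset_K: "face X \<subseteq> K"
  by (force simp: face_def mem_K_iff)

lemma walls_at_face: "X \<subseteq> S \<Longrightarrow> x \<in> face X \<Longrightarrow> walls_at x = X"
  by (force simp: face_def fixed_iff_nrm)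

lemma face_empty: "face {} = interior K"
  by (auto simp: face_def interior_K_eq)

lemma gen_fixes_face:
  assumes "X \<subseteq> S" "w \<in> gen_subgroup X" "x \<in> face X"
  shows "w x = x"
proof (rule gen_fixes[OF assms(1) _ assms(2)])
  show "s x = x" if "s \<in> X" for s
    using that walls_at_face[OF assms(1,3)] by blast
qed

lemma bij_betw_left_mult:
  assumes "X \<subseteq> S" "s \<in> X"
  shows "bij_betw (\<lambda>g. s \<circ> g) (gen_subgroup X) (gen_subgroup X)"
    and "bij_betw (\<lambda>g. g \<circ> s) (gen_subgroup X) (gen_subgroup X)"
proof -
  have s: "s \<in> S" "s \<in> gen_subgroup X" using assms gen_incl by auto
  have l: "s \<circ> (s \<circ> g) = g" and r: "g \<circ> s \<circ> s = g" for g
    by (rule ext, simp add: S_S[OF s(1)])+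
  show "bij_betw (\<lambda>g. s \<circ> g) (gen_subgroup X) (gen_subgroup X)"
  proof (rule bij_betw_byWitness[where f' = "\<lambda>g. s \<circ> g"])
    show "(\<lambda>g. s \<circ> g) ` gen_subgroup X \<subseteq> gen_subgroup X"
      using gen_comp[OF assms(1) s(2)] by blast
    then show "(\<lambda>g. s \<circ> g) ` gen_subgroup X \<subseteq> gen_subgroup X" .
  qed (rule ballI, rule l)+
  show "bij_betw (\<lambda>g. g \<circ> s) (gen_subgroup X) (gen_subgroup X)"
  proof (rule bij_betw_byWitness[where f' = "\<lambda>g. g \<circ> s"])
    show "(\<lambda>g. g \<circ> s) ` gen_subgroup X \<subseteq> gen_subgroup X"
      using gen_comp[OF assms(1) _ s(2)] by blast
    then show "(\<lambda>g. g \<circ> s) ` gen_subgroup X \<subseteq> gen_subgroup X" .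
  qed (rule ballI, rule r)+
qed

text \<open>The sum of the orbit of \<open>c0\<close> under the finite group is fixed by every
  generator in \<open>X\<close>, and the other normals are positive on each summand by
  \<open>parabolic_positive\<close>.\<close>

lemma face_nonempty:
  assumes X: "X \<subseteq> S" and fin: "finite (gen_subgroup X)"
  shows "face X \<noteq> {}"
proof -
  let ?G = "gen_subgroup X"
  define z where "z = (\<Sum>w\<in>?G. w c0)"
  have "nrm s \<bullet> z = 0" if s: "s \<in> X" for s
  proof -
    have "s z = (\<Sum>w\<in>?G. (s \<circ> w) c0)"
      using linear_sum[of s] S_involution[of s] s X by (auto simp: z_def)
    also have "\<dots> = z"
      unfolding z_def by (rule sum.reindex_bij_betw[OF bij_betw_left_mult(1)[OF X s]])
    finally show ?thesis using s X fixed_iff_nrm by blast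
  qed
  moreover have "0 < nrm t \<bullet> z" if t: "t \<in> S" "t \<notin> X" for t
    unfolding z_def inner_sum_right
    using parabolic_positive[OF X t] gen_id[OF X] by (intro sum_pos fin) auto
  ultimately have "z \<in> face X" by (simp add: face_def)
  then show ?thesis by blast
qed

text \<open>Maximise \<open>\<lambda>w. B (w v) c\<^sub>0\<close> over the finite group for an invariant inner product \<open>B\<close>.\<close>

lemma parabolic_cover:
  assumes X: "X \<subseteq> S" and fin: "finite (gen_subgroup X)"
  obtains w where "w \<in> gen_subgroup X" "\<And>s. s \<in> X \<Longrightarrow> 0 \<le> nrm s \<bullet> w v"
proof -
  let ?G = "gen_subgroup X"
  \<comment> \<open>Averaging over the finite group makes \<open>B\<close> invariant under each
    \<open>s\<close> in \<open>X\<close>. It is positive definite because the identity contributes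
    the original inner product.\<close>
  define B where "B x y = (\<Sum>g\<in>?G. g x \<bullet> g y)" for x y
  have lin: "linear g" if "g \<in> ?G" for g using gen_W[OF X that] W_linear by blast
  have B_diff: "B (x - y) z = B x z - B y z" "B z (x - y) = B z x - B z y" for x y z
    unfolding B_def using lin
    by (simp_all add: linear_diff inner_diff_left inner_diff_right sum_subtractf)
  have B_scale: "B (k *\<^sub>R x) z = k * B x z" for k x z
    unfolding B_def sum_distrib_left using lin by (intro sum.cong) (simp_all add: linear_cmul)
  have B_commute: "B x y = B y x" for x y by (simp add: B_def inner_commute)
  have B_inv: "B (s x) (s y) = B x y" if "s \<in> X" for s x y
    unfolding B_def
    using sum.reindex_bij_betw[OF bij_betw_left_mult(2)[OF X that], of "\<lambda>g. g x \<bullet> g y"] by simp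
  have B_pos: "0 < B x x" if "x \<noteq> 0" for x
    unfolding B_def using gen_id[OF X] that by (intro sum_pos2[OF fin, of id]) auto
  have "Max ((\<lambda>g. B (g v) c0) ` ?G) \<in> (\<lambda>g. B (g v) c0) ` ?G"
    using gen_id[OF X] fin by (intro Max_in) auto
  then obtain w where w: "w \<in> ?G" "Max ((\<lambda>g. B (g v) c0) ` ?G) = B (w v) c0" by auto
  have max: "B (g v) c0 \<le> B (w v) c0" if "g \<in> ?G" for g
    using Max_ge[of "(\<lambda>g. B (g v) c0) ` ?G" "B (g v) c0"] fin that w(2) by simp
  show thesis
  proof (rule that[OF w(1)])
    fix s assume s: "s \<in> X"
    then have sS: "s \<in> S" "linear s" using X S_involution by auto
    define x where "x = w v"
    define k where "k = (nrm s \<bullet> x) / (nrm s \<bullet> c0)"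
    \<comment> \<open>Both \<open>x - s x\<close> and \<open>c0 - s c0\<close> are negated by
      \<open>s\<close>. The factor \<open>k\<close> puts \<open>f\<close> on the wall as well, so
      \<open>f\<close> is both fixed and negated, hence zero.\<close>
    define f where "f = (x - s x) - k *\<^sub>R (c0 - s c0)"
    have c: "0 < nrm s \<bullet> c0" using c0_pos sS by blast
    have "nrm s \<bullet> f = 0"
      using c by (simp add: f_def k_def inner_diff_right nrm_reflect[OF sS(1)])
    then have "s f = f" by (simp add: fixed_iff_nrm[OF sS(1)])
    moreover have "s f = (s x - x) - k *\<^sub>R (s c0 - c0)"
      unfolding f_def linear_diff[OF sS(2)] linear_cmul[OF sS(2)] S_S[OF sS(1)] ..
    then have "s f = - f" by (simp add: f_def algebra_simps)
    ultimately have "f = - f" by (rule trans[OF sym])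
    then have "2 *\<^sub>R f = 0" by (simp only: scaleR_2 eq_neg_iff_add_eq_0)
    then have "f = 0" by simp
    then have xk: "x - s x = k *\<^sub>R (c0 - s c0)" by (simp add: f_def)
    have "B x c0 - B (s x) c0 = k * (B c0 c0 - B (s c0) c0)"
      using arg_cong[OF xk, of "\<lambda>y. B y c0"] by (simp add: B_diff B_scale)
    moreover have "B (s x) c0 \<le> B x c0"
      using max[OF gen_comp[OF X gen_incl[OF X s] w(1)]] by (simp add: x_def)
    ultimately have k: "0 \<le> k * (B c0 c0 - B (s c0) c0)" by simp
    have "nrm s \<bullet> (c0 - s c0) \<noteq> 0" using c by (simp add: inner_diff_right nrm_reflect[OF sS(1)])
    then have "c0 - s c0 \<noteq> 0" by auto
    then have "0 < B (c0 - s c0) (c0 - s c0)" by (rule B_pos)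
    \<comment> \<open>By invariance, \<open>B\<close> of \<open>c0 - s c0\<close> with itself is
      twice this difference. Maximality of \<open>w\<close> then makes \<open>k\<close> nonnegative,
      and \<open>k\<close> has the sign of \<open>nrm s \<bullet> w v\<close>.\<close>
    then have "0 < B c0 c0 - B (s c0) c0"
      using B_inv[OF s, of c0 c0] B_commute[of c0 "s c0"] by (simp add: B_diff)
    then have "0 \<le> k" using k by (simp add: zero_le_mult_iff)
    then show "0 \<le> nrm s \<bullet> w v" using c by (simp add: k_def x_def zero_le_divide_iff)
  qed
qed

text \<open>\<open>N\<close> is an open neighbourhood of the face on which the walls outside
  \<open>X\<close> stay positive after every move by the parabolic subgroup.
  \<open>parabolic_cover\<close> repairs the walls in \<open>X\<close> by such a move, so all of
  \<open>N\<close> lies in translates of \<open>K\<close>.\<close>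

lemma face_subset_I:
  assumes X: "X \<subseteq> S" and fin: "finite (gen_subgroup X)"
  shows "face X \<subseteq> I"
proof
  fix z assume z: "z \<in> face X"
  define N where "N = (\<Inter>w\<in>gen_subgroup X. \<Inter>t\<in>S - X. {y. 0 < nrm t \<bullet> w y})"
  have "open {y. 0 < nrm t \<bullet> w y}" if "w \<in> gen_subgroup X" for t w
    using linear_continuous_on[of w UNIV] W_linear[OF gen_W[OF X that]]
    by (intro open_Collect_less continuous_intros) (simp add: linear_linear)
  then have "open N" unfolding N_def using fin finite_S by (intro open_INT ballI) auto
  moreover have "0 < nrm t \<bullet> w z" if "w \<in> gen_subgroup X" "t \<in> S - X" for w t
    using z that gen_fixes_face[OF X that(1) z] by (simp add: face_def)
  then have "z \<in> N" by (simp add: N_def)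
  moreover have "N \<subseteq> T"
  proof
    fix y assume y: "y \<in> N"
    obtain w where w: "w \<in> gen_subgroup X" "\<And>s. s \<in> X \<Longrightarrow> 0 \<le> nrm s \<bullet> w y"
      using parabolic_cover[OF X fin, of y] by blast
    have wW: "w \<in> W" using gen_W[OF X w(1)] .
    have "0 \<le> nrm s \<bullet> w y" if "s \<in> S" for s
      using w y that by (cases "s \<in> X") (auto simp: N_def less_imp_le)
    then have "w y \<in> K" by (simp add: mem_K_iff)
    then have "inv_map w (w y) \<in> T" using W_inverse[OF wW] by blast
    then show "y \<in> T" by (simp add: W_inv[OF wW])
  qed
  ultimately show "z \<in> I" unfolding I_eq by (meson interior_maximal subsetD)
qed

lemma positive_normal:
  assumes "r \<in> W" "reflection r"
  shows "\<exists>b. fixed_space r = {x. b \<bullet> x = 0} \<and> 0 < b \<bullet> c0 \<and> (\<forall>x\<in>K. 0 \<le> b \<bullet> x)"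
proof (rule reflection_normal[OF assms(2)])
  fix a assume a: "fixed_space r = {x. a \<bullet> x = 0}"
  define b where "b = (if 0 < a \<bullet> c0 then a else - a)"
  have "a \<bullet> c0 \<noteq> 0" using not_on_hyperplane[OF assms W_id c0] a by auto
  then have b: "fixed_space r = {x. b \<bullet> x = 0}" "0 < b \<bullet> c0" using a by (auto simp: b_def)
  moreover have "0 \<le> b \<bullet> x" if "x \<in> K" for x
    using same_side_sign[OF assms W_id that b(1)] b(2) by simp
  ultimately show ?thesis by blast
qed

text \<open>Extending the segment from \<open>c\<^sub>0\<close> to \<open>p\<close> a little beyond \<open>p\<close> ends in some \<open>w K\<close>, and every
  hyperplane through \<open>p\<close> separates \<open>C\<^sub>0\<close> from \<open>w C\<^sub>0\<close>.\<close>

lemma finite_parabolic: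
  assumes p: "p \<in> K" "p \<in> I"
  shows "finite (gen_subgroup (walls_at p))"
proof -
  let ?G = "gen_subgroup (walls_at p)"
  have X: "walls_at p \<subseteq> S" by auto
  have "open I" by (simp add: I_eq)
  then obtain e where e: "0 < e" "ball p e \<subseteq> I" using p(2) open_contains_ball by blast
  \<comment> \<open>Small enough to keep \<open>q\<close> within \<open>e / 2\<close> of
    \<open>p\<close>; the added 1 avoids a zero denominator.\<close>
  define d where "d = e / (2 * (norm (p - c0) + 1))"
  define q where "q = p + d *\<^sub>R (p - c0)"
  have n: "0 < norm (p - c0) + 1" by (simp add: add_nonneg_pos)
  then have d: "0 < d" using e by (simp add: d_def)
  have "d * norm (p - c0) \<le> d * (norm (p - c0) + 1)" using d by simp
  also have "\<dots> = e / 2" using n by (simp add: d_def field_simps)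
  finally have "q \<in> ball p e" using d e(1) by (simp add: q_def dist_norm)
  then have "q \<in> T" using e(2) interior_subset unfolding I_eq by blast
  then obtain w y where w: "w \<in> W" "y \<in> K" "q = w y" by blast
  obtain ss where ss: "set ss \<subseteq> S" "w = word_prod ss" using w(1) gen_words[OF order_refl] by auto
  define R where "R = {r \<in> ?G. reflection r}"
  have R: "r \<in> W" "reflection r" if "r \<in> R" for r using that gen_W[OF X] by (auto simp: R_def)
  \<comment> \<open>Each reflection in \<open>R\<close> is the conjugate of a letter of the fixed
    word \<open>ss\<close> by the prefix before it, so \<open>R\<close> has at most
    \<open>length ss\<close> elements.\<close>
  have "R \<subseteq> (\<lambda>i. word_prod (take i ss) \<circ> (ss ! i) \<circ> word_prod (rev (take i ss))) ` {..<length ss}"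
  proof
    fix r assume r: "r \<in> R"
    obtain b where b: "fixed_space r = {x. b \<bullet> x = 0}" "0 < b \<bullet> c0"
      using positive_normal[OF R[OF r]] by blast
    have "r p = p" using r gen_walls_at_fixes unfolding R_def by blast
    then have "b \<bullet> p = 0" using b(1) by (auto simp: fixed_space_def)
    then have "b \<bullet> w y < 0" using b(2) d by (simp add: w(3)[symmetric] q_def inner_add_right inner_diff_right)
    then have "\<not> 0 < b \<bullet> w c0" using same_side_sign[OF R[OF r] w(1,2) b(1)] by linarith
    moreover have "b \<bullet> w c0 \<noteq> 0" using not_on_hyperplane[OF R[OF r] w(1) c0] b(1) by simp
    ultimately have "separates (fixed_space r) c0 (word_prod ss c0)"
      using b by (simp add: separates_iff mult_less_0_iff flip: ss(2))
    then obtain xs s ys where xs: "ss = xs @ s # ys" "r \<circ> word_prod xs = word_prod xs \<circ> s"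
      using gallery_crossing[OF R[OF r] ss(1)] by blast
    have "r = word_prod xs \<circ> s \<circ> word_prod (rev xs)"
    proof
      fix x
      have "set xs \<subseteq> S" using ss(1) xs(1) by auto
      then show "r x = (word_prod xs \<circ> s \<circ> word_prod (rev xs)) x"
        using fun_cong[OF xs(2), of "word_prod (rev xs) x"] by (simp add: word_prod_rev_apply)
    qed
    moreover have "take (length xs) ss = xs" "ss ! length xs = s" "length xs < length ss"
      using xs(1) by simp_all
    ultimately show "r \<in> (\<lambda>i. word_prod (take i ss) \<circ> (ss ! i) \<circ> word_prod (rev (take i ss))) ` {..<length ss}"
      by (intro image_eqI[of _ _ "length xs"]) simp_all
  qed
  then have finR: "finite R" by (rule finite_subset) simp
  \<comment> \<open>An element of the parabolic subgroup is determined by the hyperplanes of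
    \<open>R\<close> that it crosses: for distinct \<open>u\<close> and \<open>v\<close>, a
    generator separating the chamber from its translate by \<open>inv_map u \<circ> v\<close>
    conjugates to a member of \<open>R\<close> separating \<open>u c0\<close> from
    \<open>v c0\<close>.\<close>
  have "inj_on (\<lambda>u. {r \<in> R. separates (fixed_space r) c0 (u c0)}) ?G"
  proof (rule inj_onI, rule ccontr)
    fix u v assume u: "u \<in> ?G" and v: "v \<in> ?G" and "u \<noteq> v"
      and eq: "{r \<in> R. separates (fixed_space r) c0 (u c0)} = {r \<in> R. separates (fixed_space r) c0 (v c0)}"
    have uW: "u \<in> W" and vW: "v \<in> W" using u v gen_W[OF X] by auto
    have g: "inv_map u \<circ> v \<in> ?G" using gen_comp[OF X gen_inv[OF X u] v] .
    have ne: "inv_map u \<circ> v \<noteq> id"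
    proof
      assume i: "inv_map u \<circ> v = id"
      have "u x = v x" for x using fun_cong[OF i, of x] W_inv(2)[OF uW, of "v x"] by simp
      then show False using \<open>u \<noteq> v\<close> by blast
    qed
    obtain s where s: "s \<in> walls_at p" "separates (fixed_space s) c0 ((inv_map u \<circ> v) c0)"
      by (rule exists_separating_generator[OF X g ne])
    have sS: "s \<in> W" "reflection s" using s(1) S_W reflection_S by auto
    define r where "r = u \<circ> s \<circ> inv_map u"
    have "r \<in> ?G" unfolding r_def using gen_comp[OF X gen_comp[OF X u gen_incl[OF X s(1)]] gen_inv[OF X u]] .
    then have rR: "r \<in> R" using conj_W(2)[OF uW sS] by (simp add: R_def r_def)
    have "separates (fixed_space r) (u c0) (u ((inv_map u \<circ> v) c0))"
      unfolding r_def conj_W(3)[OF uW sS] W_separates[OF uW] by (rule s(2))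
    then have "separates (fixed_space r) (u c0) (v c0)" by (simp add: W_inv[OF uW])
    then show False
      using eq rR separates_trans[OF reflection_hyperplane[OF R(2)[OF rR]], of c0 "u c0" "v c0"]
        not_on_hyperplane[OF R[OF rR] W_id c0] not_on_hyperplane[OF R[OF rR] uW c0]
        not_on_hyperplane[OF R[OF rR] vW c0] by auto
  qed
  then show ?thesis
    by (rule inj_on_finite[of _ _ "Pow R"]) (use finR in auto)
qed

section \<open>Action of the group on the arrangement and its cells\<close>

lemma A_E:
  assumes "H \<in> A"
  obtains r where "r \<in> W" "reflection r" "H = fixed_space r"
  using assms by (auto simp: coxeter_arrangement_def)

lemma fixed_space_in_A: "r \<in> W \<Longrightarrow> reflection r \<Longrightarrow> fixed_space r \<in> A"
  by (auto simp: coxeter_arrangement_def)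

lemma A_hyperplane: "H \<in> A \<Longrightarrow> linear_hyperplane H"
  by (auto simp: coxeter_arrangement_def reflection_hyperplane)

lemma W_image_A:
  assumes "w \<in> W" "H \<in> A"
  shows "w ` H \<in> A"
proof -
  obtain r where r: "r \<in> W" "reflection r" "H = fixed_space r" using assms(2) by (rule A_E)
  then show ?thesis
    using fixed_space_in_A[OF conj_W(1,2)[OF assms(1) r(1,2)]] conj_W(3)[OF assms(1) r(1,2)] by simp
qed

lemma W_mem_cell:
  assumes w: "w \<in> W" and x: "x \<in> cell A I p"
  shows "w x \<in> cell A I (w p)"
proof -
  have "(w x \<in> H \<longleftrightarrow> w p \<in> H) \<and> \<not> separates H (w p) (w x)" if H: "H \<in> A" for H
  proof -
    define H' where "H' = inv_map w ` H"
    have H': "H' \<in> A" "H = w ` H'" using W_image_A[OF W_inverse[OF w] H] inv_map_image[OF w] by (auto simp: H'_def)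
    show ?thesis
      using x H'(1) unfolding H'(2) W_separates[OF w] by (auto simp: cell_def mem_image_W[OF w] W_inv[OF w])
  qed
  then show ?thesis using x W_mem_I[OF w] by (simp add: cell_def)
qed

lemma W_image_cell:
  assumes w: "w \<in> W"
  shows "w ` cell A I p = cell A I (w p)"
proof
  show "cell A I (w p) \<subseteq> w ` cell A I p"
  proof
    fix x assume "x \<in> cell A I (w p)"
    then have "inv_map w x \<in> cell A I p" using W_mem_cell[OF W_inverse[OF w]] W_inv[OF w] by fastforce
    then show "x \<in> w ` cell A I p" by (simp add: mem_image_W[OF w])
  qed
qed (use W_mem_cell[OF w] in blast)

text \<open>One inclusion only tests the walls. For the other, \<open>K\<close> lies on one side of
  every hyperplane of \<open>A\<close>, and by \<open>stabilizer\<close> a reflection fixing a point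
  of \<open>K\<close> belongs to the parabolic subgroup of the walls there, so incidence with
  \<open>A\<close> depends on those walls alone.\<close>

lemma cell_eq_face:
  assumes p: "p \<in> K" "p \<in> I"
  shows "cell A I p = face (walls_at p)"
proof
  have X: "walls_at p \<subseteq> S" by auto
  show "cell A I p \<subseteq> face (walls_at p)"
  proof
    fix x assume x: "x \<in> cell A I p"
    have "(s \<in> walls_at p \<longrightarrow> nrm s \<bullet> x = 0) \<and> (s \<notin> walls_at p \<longrightarrow> 0 < nrm s \<bullet> x)" if s: "s \<in> S" for s
    proof -
      have "fixed_space s \<in> A" using fixed_space_in_A S_W reflection_S s by blast
      then have "x \<in> fixed_space s \<longleftrightarrow> p \<in> fixed_space s" "\<not> separates (fixed_space s) p x"
        using x unfolding cell_def by blast+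
      then have "nrm s \<bullet> x = 0 \<longleftrightarrow> nrm s \<bullet> p = 0" "\<not> (nrm s \<bullet> p) * (nrm s \<bullet> x) < 0"
        by (simp_all add: fixed_space_nrm[OF s] separates_iff)
      then show ?thesis
        using nrm_K[OF s p(1)] s by (auto simp: fixed_iff_nrm[OF s] mult_less_0_iff)
    qed
    then show "x \<in> face (walls_at p)" by (simp add: face_def)
  qed
  show "face (walls_at p) \<subseteq> cell A I p"
  proof
    fix x assume x: "x \<in> face (walls_at p)"
    have xK: "x \<in> K" using x face_subset_K by blast
    have wx: "walls_at x = walls_at p" using walls_at_face[OF X x] .
    have "(x \<in> H \<longleftrightarrow> p \<in> H) \<and> \<not> separates H p x" if H: "H \<in> A" for H
    proof -
      obtain r where r: "r \<in> W" "reflection r" "H = fixed_space r" using H by (rule A_E)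
      have same: "z' \<in> H" if "z \<in> H" "z \<in> K" "z' \<in> K" "walls_at z = walls_at z'" for z z'
      proof -
        have "r z = z" using that(1) r(3) by (simp add: fixed_space_def)
        then have "r \<in> gen_subgroup (walls_at z)" using stabilizer[OF that(2) r(1)] that(2) by simp
        then have "r \<in> gen_subgroup (walls_at z')" by (simp only: that(4))
        then have "r z' = z'" by (rule gen_walls_at_fixes)
        then show ?thesis using r(3) by (simp add: fixed_space_def)
      qed
      obtain b where "H = {x. b \<bullet> x = 0}" "\<And>x. x \<in> K \<Longrightarrow> 0 \<le> b \<bullet> x"
        using positive_normal[OF r(1,2)] r(3) by blast
      then have "\<not> separates H p x" using xK p(1) by (simp add: separates_iff not_less)
      moreover have "p \<in> H \<Longrightarrow> x \<in> H" by (rule same[OF _ p(1) xK wx[symmetric]])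
      moreover have "x \<in> H \<Longrightarrow> p \<in> H" by (rule same[OF _ xK p(1) wx])
      ultimately show ?thesis by blast
    qed
    moreover have "x \<in> I" using x face_subset_I[OF X finite_parabolic[OF p]] by blast
    ultimately show "x \<in> cell A I p" by (simp add: cell_def)
  qed
qed

section \<open>The Salvetti poset\<close>

lemma gen_empty: "gen_subgroup ({} :: ('a \<Rightarrow> 'a) set) = {id}"
  using gen_words[of "{}"] by auto

lemma c0_in_I: "c0 \<in> I"
  using face_subset_I[of "{}"] c0 by (simp add: gen_empty face_empty subset_iff)

lemma W_c0: "w \<in> W \<Longrightarrow> w c0 \<in> I - \<Union>A"
  using not_on_hyperplane[OF _ _ _ c0] c0_in_I W_mem_I by (auto elim!: A_E)

lemma cell_c0: "cell A I c0 = interior K"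
  using cell_eq_face[OF c0_in_K c0_in_I] walls_at_face[of "{}" c0] c0 by (simp add: face_empty)

text \<open>A point of \<open>I\<close> off all hyperplanes has the form \<open>w y\<close> with
  \<open>y\<close> in \<open>K\<close>. A wall through \<open>y\<close> would be carried by
  \<open>w\<close> to a member of \<open>A\<close> through the point, so \<open>y\<close> is
  interior.\<close>

lemma chambers_A: "chambers A I = (\<lambda>w. w ` interior K) ` W"
proof -
  have ch: "chambers A I = cell A I ` (I - \<Union>A)"
    using convex_I A_hyperplane by (rule chambers_eq_cells)
  show ?thesis
  proof (intro equalityI subsetI)
    fix C assume "C \<in> (\<lambda>w. w ` interior K) ` W"
    then obtain w where w: "w \<in> W" "C = w ` interior K" by blast
    then have "C = cell A I (w c0)" using W_image_cell[OF w(1)] cell_c0 by metis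
    then show "C \<in> chambers A I" unfolding ch using W_c0[OF w(1)] by blast
  next
    fix C assume "C \<in> chambers A I"
    then obtain p where p: "p \<in> I" "p \<notin> \<Union>A" "C = cell A I p" unfolding ch by blast
    have "p \<in> T" using p(1) interior_subset unfolding I_eq by blast
    then obtain w y where w: "w \<in> W" "y \<in> K" "p = w y" by blast
    have yI: "y \<in> I" using p(1) w by (simp add: W_mem_I)
    have "walls_at y = {}"
    proof (rule ccontr)
      assume "walls_at y \<noteq> {}"
      then obtain s where s: "s \<in> S" "s y = y" by blast
      then have "w ` fixed_space s \<in> A"
        using W_image_A[OF w(1) fixed_space_in_A[OF S_W reflection_S]] by blast
      moreover have "p \<in> w ` fixed_space s" using s w(3) by (auto simp: fixed_space_def)
      ultimately show False using p(2) by blast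
    qed
    then have "cell A I y = interior K" using cell_eq_face[OF w(2) yI] by (simp only: face_empty)
    then have "C = w ` interior K" using W_image_cell[OF w(1), of y] p(3) w(3) by simp
    then show "C \<in> (\<lambda>w. w ` interior K) ` W" using w(1) by blast
  qed
qed

lemma closure_W_image: "w \<in> W \<Longrightarrow> closure (w ` Z) = w ` closure Z"
  using closure_injective_linear_image[OF W_linear bij_is_inj[OF W_bij], of w Z] by simp

lemma chamber_inj:
  assumes u: "u \<in> W" and v: "v \<in> W" and eq: "u ` interior K = v ` interior K"
  shows "u = v"
proof -
  have "(inv_map v \<circ> u) ` interior K = interior K"
    unfolding image_comp[symmetric] eq by (rule inv_map_image(1)[OF v])
  then have "inv_map v \<circ> u = id"
    using disjoint_id[OF W_comp[OF W_inverse[OF v] u]] interior_K_nonempty by auto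
  then have "inv_map v (u x) = x" for x by (rule pointfree_idE)
  then have "u x = v x" for x using W_inv(2)[OF v, of "u x"] by simp
  then show ?thesis by blast
qed

section \<open>Facets of the fundamental chamber and the map \<open>iota\<close>\<close>

lemma facet_le_chamber: "facet_le I F (interior K) \<longleftrightarrow> F \<subseteq> K \<inter> I"
  by (simp add: facet_le_def closure_interior_K)

lemma facets_A: "facets A I = cell A I ` I"
  using convex_I A_hyperplane by (rule facets_eq_cells)

lemma finite_type_subset: "X \<in> finite_type_subsets S \<Longrightarrow> X \<subseteq> S"
  and finite_type_finite: "X \<in> finite_type_subsets S \<Longrightarrow> finite (gen_subgroup X)"
  by (auto simp: finite_type_subsets_def)

lemma face_eq_cell:
  assumes X: "X \<in> finite_type_subsets S"
  obtains p where "p \<in> face X" "p \<in> K" "p \<in> I" "walls_at p = X" "face X = cell A I p"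
proof -
  have X': "X \<subseteq> S" "finite (gen_subgroup X)" using X by (auto simp: finite_type_subsets_def)
  obtain p where p: "p \<in> face X" using face_nonempty[OF X'] by blast
  then have pKI: "p \<in> K" "p \<in> I" using face_subset_K face_subset_I[OF X'] by auto
  have w: "walls_at p = X" by (rule walls_at_face[OF X'(1) p])
  have "face X = cell A I p" using cell_eq_face[OF pKI] by (simp only: w)
  then show thesis by (rule that[OF p pKI w])
qed

text \<open>Points of \<open>K\<close> in the Tits cone have finite parabolic subgroups by
  \<open>finite_parabolic\<close>; conversely \<open>face_subset_I\<close> puts the faces of finite
  type inside the cone.\<close>

lemma chamber_facets_eq: "chamber_facets K S = face ` finite_type_subsets S"
proof (intro equalityI subsetI)
  fix F assume "F \<in> chamber_facets K S"
  then obtain p where p: "p \<in> I" "F = cell A I p" "F \<subseteq> K \<inter> I"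
    by (auto simp: chamber_facets_def facets_A facet_le_chamber)
  have "p \<in> F" unfolding p(2) using p(1) A_hyperplane by (rule mem_cell_self)
  then have pK: "p \<in> K" using p(3) by blast
  have "walls_at p \<in> finite_type_subsets S"
    using finite_parabolic[OF pK p(1)] by (simp add: finite_type_subsets_def)
  moreover have "F = face (walls_at p)" using cell_eq_face[OF pK p(1)] p(2) by (simp only:)
  ultimately show "F \<in> face ` finite_type_subsets S" by blast
next
  fix F assume "F \<in> face ` finite_type_subsets S"
  then obtain X where X: "X \<in> finite_type_subsets S" "F = face X" by blast
  obtain p where "p \<in> I" "face X = cell A I p" using face_eq_cell[OF X(1)] by blast
  then have "F \<in> facets A I" unfolding facets_A X(2) by blast
  moreover have "F \<subseteq> K \<inter> I"
    using face_subset_K face_subset_I[OF finite_type_subset finite_type_finite, OF X(1) X(1)] X(2) by blast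
  ultimately show "F \<in> chamber_facets K S"
    by (simp add: chamber_facets_def facet_le_chamber)
qed

text \<open>From a point \<open>p\<close> of the face, a small move along any \<open>y\<close> of
  the intersection stays in the face, so \<open>y\<close> is a multiple of a difference of two of
  its points.\<close>

lemma span_face:
  assumes X: "X \<in> finite_type_subsets S"
  shows "span (face X) = (\<Inter>s\<in>X. fixed_space s)"
proof
  have XS: "X \<subseteq> S" using X by (rule finite_type_subset)
  have "subspace (\<Inter>s\<in>X. fixed_space s)"
    using XS reflection_S reflection_hyperplane linear_hyperplane_subspace
    by (intro subspace_Inter) blast
  moreover have "face X \<subseteq> (\<Inter>s\<in>X. fixed_space s)"
    using XS by (fastforce simp: face_def fixed_space_nrm)
  ultimately show "span (face X) \<subseteq> (\<Inter>s\<in>X. fixed_space s)" by (intro span_minimal)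
  show "(\<Inter>s\<in>X. fixed_space s) \<subseteq> span (face X)"
  proof
    fix y assume y: "y \<in> (\<Inter>s\<in>X. fixed_space s)"
    have y0: "nrm s \<bullet> y = 0" if "s \<in> X" for s using y that XS fixed_space_nrm[of s] by blast
    obtain p where p: "p \<in> face X" using face_eq_cell[OF X] by blast
    have "\<exists>e>0. \<forall>t\<in>S - X. 0 < nrm t \<bullet> p + e * (nrm t \<bullet> y)"
      using finite_S p by (intro finite_positive_perturbation) (auto simp: face_def)
    then obtain e where e: "0 < e" "\<And>t. t \<in> S \<Longrightarrow> t \<notin> X \<Longrightarrow> 0 < nrm t \<bullet> p + e * (nrm t \<bullet> y)"
      by blast
    have "p + e *\<^sub>R y \<in> face X"
      using p e y0 by (simp add: face_def inner_add_right)
    then have "(1 / e) *\<^sub>R ((p + e *\<^sub>R y) - p) \<in> span (face X)"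
      using p by (intro span_scale span_diff span_base)
    then show "y \<in> span (face X)" using e(1) by simp
  qed
qed

text \<open>A point of \<open>face Y\<close> lies in the intersection over \<open>Y\<close> and on
  no walls but those in \<open>Y\<close>. Used in both directions, this recovers the subset from its
  support.\<close>

lemma Inter_fixed_space_subset:
  assumes X: "X \<subseteq> S" and Y: "Y \<in> finite_type_subsets S"
    and eq: "(\<Inter>s\<in>Y. fixed_space s) \<subseteq> (\<Inter>s\<in>X. fixed_space s)"
  shows "X \<subseteq> Y"
proof
  fix s assume s: "s \<in> X"
  obtain p where p: "p \<in> face Y" "walls_at p = Y" using face_eq_cell[OF Y] by blast
  have "p \<in> (\<Inter>s\<in>Y. fixed_space s)" using p(1) span_base[of p "face Y"] span_face[OF Y] by blast
  then have "s p = p" using eq s by (auto simp: fixed_space_def)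
  then have "s \<in> walls_at p" using s X by blast
  then show "s \<in> Y" by (simp only: p(2))
qed

lemma iota_eq_face:
  assumes X: "X \<in> finite_type_subsets S"
  shows "iota K S X = face X"
  unfolding iota_def
proof (rule the_equality)
  show "face X \<in> chamber_facets K S \<and> span (face X) = (\<Inter>s\<in>X. fixed_space s)"
    using X span_face chamber_facets_eq by blast
  fix F assume F: "F \<in> chamber_facets K S \<and> span F = (\<Inter>s\<in>X. fixed_space s)"
  then obtain Y where Y: "Y \<in> finite_type_subsets S" "F = face Y" unfolding chamber_facets_eq by blast
  have "(\<Inter>s\<in>X. fixed_space s) = (\<Inter>s\<in>Y. fixed_space s)" using F span_face[OF Y(1)] Y(2) by blast
  then have "X = Y"
    using Inter_fixed_space_subset[OF finite_type_subset[OF X] Y(1)]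
      Inter_fixed_space_subset[OF finite_type_subset[OF Y(1)] X] by blast
  then show "F = face X" using Y(2) by simp
qed

lemma phi_eq: "X \<in> finite_type_subsets S \<Longrightarrow> phi K S (w, X) = (w ` face X, w ` interior K)"
  by (simp add: phi_def iota_eq_face)

section \<open>Bijectivity of \<open>phi\<close>\<close>

lemma inj_on_phi: "inj_on (phi K S) (W \<times> finite_type_subsets S)"
proof (rule inj_onI, clarify)
  fix u X v Y
  assume u: "u \<in> W" "X \<in> finite_type_subsets S" and v: "v \<in> W" "Y \<in> finite_type_subsets S"
    and eq: "phi K S (u, X) = phi K S (v, Y)"
  have uv: "u = v" using chamber_inj[OF u(1) v(1)] eq by (simp add: phi_eq u v)
  have "u ` face X = u ` face Y" using eq uv by (simp add: phi_eq u v)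
  then have "face X = face Y" using inv_map_image(1)[OF u(1)] by metis
  then have "(\<Inter>s\<in>X. fixed_space s) = (\<Inter>s\<in>Y. fixed_space s)" using span_face u v by metis
  then have "X = Y"
    using Inter_fixed_space_subset[OF finite_type_subset[OF u(2)] v(2)]
      Inter_fixed_space_subset[OF finite_type_subset[OF v(2)] u(2)] by blast
  then show "u = v \<and> X = Y" using uv by blast
qed

lemma W_image_facets:
  assumes "w \<in> W" "F \<in> facets A I"
  shows "w ` F \<in> facets A I"
proof -
  obtain p where "p \<in> I" "F = cell A I p" using assms(2) unfolding facets_A by blast
  then have "w p \<in> I" "w ` F = cell A I (w p)" using W_mem_I W_image_cell assms(1) by auto
  then show ?thesis unfolding facets_A by blast
qed

lemma W_facet_le:
  assumes "w \<in> W"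
  shows "facet_le I (w ` F) (w ` interior K) \<longleftrightarrow> facet_le I F (interior K)"
proof -
  have "w ` F \<subseteq> w ` K \<inter> I \<longleftrightarrow> w ` F \<subseteq> w ` (K \<inter> I)"
    using W_image_I[OF assms] image_Int[OF bij_is_inj[OF W_bij[OF assms]], of K I] by simp
  also have "\<dots> \<longleftrightarrow> F \<subseteq> K \<inter> I"
    by (rule inj_image_subset_iff[OF bij_is_inj[OF W_bij[OF assms]]])
  finally show ?thesis
    by (simp add: facet_le_def closure_W_image[OF assms] closure_interior_K)
qed

lemma phi_image: "phi K S ` (W \<times> finite_type_subsets S) = Sal0 A I"
proof (intro equalityI subsetI)
  fix Z assume "Z \<in> phi K S ` (W \<times> finite_type_subsets S)"
  then obtain w X where wX: "w \<in> W" "X \<in> finite_type_subsets S" "Z = phi K S (w, X)" by blast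
  have "face X \<in> chamber_facets K S" using wX(2) chamber_facets_eq by blast
  then have F: "face X \<in> facets A I" "facet_le I (face X) (interior K)"
    by (auto simp: chamber_facets_def)
  have "w ` interior K \<in> chambers A I" using wX(1) chambers_A by blast
  then show "Z \<in> Sal0 A I"
    using W_image_facets[OF wX(1) F(1)] F(2) by (simp add: wX phi_eq Sal0_def W_facet_le)
next
  fix Z assume "Z \<in> Sal0 A I"
  then obtain F C where Z: "Z = (F, C)" "F \<in> facets A I" "C \<in> chambers A I" "facet_le I F C"
    by (auto simp: Sal0_def)
  obtain w where w: "w \<in> W" "C = w ` interior K" using Z(3) unfolding chambers_A by blast
  \<comment> \<open>Translating back by \<open>w\<close> moves the pair to the fundamental chamber,
    whose facets are known.\<close>
  define F' where "F' = inv_map w ` F"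
  have F: "F = w ` F'" using inv_map_image(2)[OF w(1)] by (simp add: F'_def)
  have "F' \<in> facets A I" unfolding F'_def by (rule W_image_facets[OF W_inverse[OF w(1)] Z(2)])
  moreover have "facet_le I F' (interior K)" using Z(4) unfolding F w(2) W_facet_le[OF w(1)] .
  ultimately have "F' \<in> chamber_facets K S" by (simp add: chamber_facets_def)
  then obtain X where X: "X \<in> finite_type_subsets S" "F' = face X" unfolding chamber_facets_eq by blast
  then have "Z = phi K S (w, X)" using Z(1) w(2) F by (simp add: phi_eq)
  then show "Z \<in> phi K S ` (W \<times> finite_type_subsets S)" using w(1) X(1) by blast
qed

section \<open>Comparison of the two orders\<close>

lemma face_subset_closure:
  assumes XY: "X \<subseteq> Y" and ne: "face X \<noteq> {}"
  shows "face Y \<subseteq> closure (face X)"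
proof
  fix y assume y: "y \<in> face Y"
  obtain p where p: "p \<in> face X" using ne by blast
  show "y \<in> closure (face X)"
    unfolding closure_approachable
  proof (intro allI impI)
    fix e :: real assume e: "0 < e"
    define d where "d = e / (2 * (norm p + 1))"
    have n: "0 < norm p + 1" by (simp add: add_nonneg_pos)
    then have d: "0 < d" using e by (simp add: d_def)
    have "d * norm p \<le> d * (norm p + 1)" using d by simp
    also have "\<dots> = e / 2" using n by (simp add: d_def field_simps)
    finally have "dist (y + d *\<^sub>R p) y < e" using d e by (simp add: dist_norm)
    \<comment> \<open>Walls in \<open>X\<close> vanish at both points; a wall in \<open>Y\<close>
      but not in \<open>X\<close> becomes positive through \<open>p\<close>; walls outside
      \<open>Y\<close> are positive at both.\<close>
    moreover have "y + d *\<^sub>R p \<in> face X"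
    proof -
      have "(s \<in> X \<longrightarrow> nrm s \<bullet> (y + d *\<^sub>R p) = 0) \<and> (s \<notin> X \<longrightarrow> 0 < nrm s \<bullet> (y + d *\<^sub>R p))"
        if "s \<in> S" for s
      proof -
        have "s \<in> X \<Longrightarrow> nrm s \<bullet> p = 0" "s \<notin> X \<Longrightarrow> 0 < d * (nrm s \<bullet> p)" "s \<in> Y \<Longrightarrow> nrm s \<bullet> y = 0"
          "s \<notin> Y \<Longrightarrow> 0 < nrm s \<bullet> y"
          using p y that d by (auto simp: face_def)
        then show ?thesis using XY by (cases "s \<in> Y") (auto simp: inner_add_right)
      qed
      then show ?thesis by (simp add: face_def)
    qed
    ultimately show "\<exists>x\<in>face X. dist x y < e" by blast
  qed
qed

lemma closure_face_fixed:
  assumes "X \<subseteq> S" "s \<in> X" "y \<in> closure (face X)"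
  shows "s y = y"
proof -
  have s: "s \<in> S" using assms by blast
  have "face X \<subseteq> fixed_space s" using assms(2) s by (auto simp: face_def fixed_space_nrm)
  moreover have "closed (fixed_space s)" unfolding fixed_space_nrm[OF s] by (rule closed_hyperplane)
  ultimately have "closure (face X) \<subseteq> fixed_space s" by (rule closure_minimal)
  then show ?thesis using assms(3) by (auto simp: fixed_space_def)
qed

lemma empty_minimal_iff:
  "w \<in> W \<Longrightarrow> empty_minimal S X w \<longleftrightarrow> (\<forall>h\<in>gen_subgroup X. word_length S w \<le> word_length S (w \<circ> h))"
  by (simp add: empty_minimal_def l_coset_def GL_def)

lemma image_comp_gen_face:
  assumes "h \<in> gen_subgroup X" "X \<subseteq> S"
  shows "(w \<circ> h) ` face X = w ` face X"
  using gen_fixes_face[OF assms(2,1)] by (auto simp: image_def)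

text \<open>If \<open>H = H\<^sub>r\<close> contains \<open>w (face X)\<close>, then \<open>w\<inverse> r w\<close> lies in \<open>W\<^sub>X\<close>, so that
  \<open>r w \<in> w W\<^sub>X\<close>.\<close>

lemma minimal_imp_not_separated:
  assumes X: "X \<in> finite_type_subsets S" and w: "w \<in> W" and min: "empty_minimal S X w"
    and H: "H \<in> A" "w ` face X \<subseteq> H"
  shows "\<not> separates H c0 (w c0)"
proof
  assume sep: "separates H c0 (w c0)"
  obtain r where r: "r \<in> W" "reflection r" "H = fixed_space r" using H(1) by (rule A_E)
  define h where "h = inv_map w \<circ> r \<circ> w"
  have hW: "h \<in> W" unfolding h_def using W_comp[OF W_comp[OF W_inverse[OF w] r(1)] w] .
  obtain p where p: "p \<in> face X" "p \<in> K" "walls_at p = X" using face_eq_cell[OF X] by blast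
  have "r (w p) = w p" using H(2) p(1) r(3) by (auto simp: fixed_space_def)
  then have "h p = p" by (simp add: h_def W_inv[OF w])
  then have "h \<in> gen_subgroup (walls_at p)" using stabilizer[OF p(2) hW] p(2) by simp
  then have hX: "h \<in> gen_subgroup X" by (simp only: p(3))
  have "w \<circ> h = r \<circ> w" by (rule ext) (simp add: h_def W_inv[OF w])
  then have "word_length S w \<le> word_length S (r \<circ> w)"
    using min hX unfolding empty_minimal_iff[OF w] by metis
  moreover have "word_length S (r \<circ> w) < word_length S w"
    using strong_exchange(2)[OF order_refl w r(1,2)] sep r(3) by blast
  ultimately show False by linarith
qed

text \<open>For the converse, let \<open>w \<circ> m\<close> be a shortest element of the coset. No
  hyperplane containing the translated face separates \<open>c0\<close> from \<open>w c0\<close> or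
  from \<open>w (m c0)\<close>. If \<open>m\<close> were not the identity, a generator in
  \<open>X\<close> would give such a hyperplane between the latter two points.\<close>

lemma minimal_iff_not_separated:
  assumes X: "X \<in> finite_type_subsets S" and w: "w \<in> W"
  shows "empty_minimal S X w \<longleftrightarrow> (\<forall>H\<in>A. w ` face X \<subseteq> H \<longrightarrow> \<not> separates H c0 (w c0))"
proof
  assume "empty_minimal S X w"
  then show "\<forall>H\<in>A. w ` face X \<subseteq> H \<longrightarrow> \<not> separates H c0 (w c0)"
    using minimal_imp_not_separated[OF X w] by blast
next
  assume ns: "\<forall>H\<in>A. w ` face X \<subseteq> H \<longrightarrow> \<not> separates H c0 (w c0)"
  have XS: "X \<subseteq> S" using X by (rule finite_type_subset)
  obtain m where m: "m \<in> gen_subgroup X"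
    "\<And>h. h \<in> gen_subgroup X \<Longrightarrow> word_length S (w \<circ> m) \<le> word_length S (w \<circ> h)"
    using ex_has_least_nat[of "\<lambda>h. h \<in> gen_subgroup X" id "\<lambda>h. word_length S (w \<circ> h)"] gen_id[OF XS]
    by blast
  have mW: "m \<in> W" using gen_W[OF XS m(1)] .
  have wm: "w \<circ> m \<in> W" using W_comp[OF w mW] .
  have min: "empty_minimal S X (w \<circ> m)"
    unfolding empty_minimal_iff[OF wm] using m(2) gen_comp[OF XS m(1)] by (simp add: comp_assoc)
  have ns': "\<not> separates H c0 ((w \<circ> m) c0)" if "H \<in> A" "w ` face X \<subseteq> H" for H
    using minimal_imp_not_separated[OF X wm min that(1)] that(2)
    unfolding image_comp_gen_face[OF m(1) XS] by blast
  have "m = id"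
  proof (rule ccontr)
    assume ne: "m \<noteq> id"
    obtain s where s: "s \<in> X" "separates (fixed_space s) c0 (m c0)"
      by (rule exists_separating_generator[OF XS m(1) ne])
    have sS: "s \<in> S" using s(1) XS by blast
    define H where "H = w ` fixed_space s"
    have HA: "H \<in> A" unfolding H_def
      by (rule W_image_A[OF w fixed_space_in_A[OF S_W[OF sS] reflection_S[OF sS]]])
    have "face X \<subseteq> fixed_space s"
      using closure_face_fixed[OF XS s(1)] closure_subset by (auto simp: fixed_space_def)
    then have wH: "w ` face X \<subseteq> H" unfolding H_def by (rule image_mono)
    have "separates H (w c0) (w (m c0))" unfolding H_def W_separates[OF w] by (rule s(2))
    moreover have "\<not> separates H c0 (w c0)" "\<not> separates H c0 (w (m c0))"
      using ns HA wH ns'[OF HA wH] by auto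
    moreover have "c0 \<notin> H" "w c0 \<notin> H" "w (m c0) \<notin> H"
      using W_c0[OF W_id] W_c0[OF w] W_c0[OF wm] HA by auto
    ultimately show False using separates_trans[OF A_hyperplane[OF HA], of c0 "w c0" "w (m c0)"] by blast
  qed
  then show "empty_minimal S X w" using min by simp
qed

text \<open>Applying \<open>v\<close> to everything permutes \<open>A\<close> and preserves
  sides.\<close>

lemma not_separated_translate:
  assumes u: "u \<in> W" and v: "v \<in> W"
  shows "(\<forall>H\<in>A. (inv_map v \<circ> u) ` Z \<subseteq> H \<longrightarrow> \<not> separates H c0 ((inv_map v \<circ> u) c0))
    \<longleftrightarrow> (\<forall>H\<in>A. u ` Z \<subseteq> H \<longrightarrow> \<not> separates H (v c0) (u c0))"
proof -
  have vu: "v ` (inv_map v \<circ> u) ` Z = u ` Z"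
    unfolding image_comp[symmetric] by (rule inv_map_image(2)[OF v])
  have *: "(inv_map v \<circ> u) ` Z \<subseteq> H \<longleftrightarrow> u ` Z \<subseteq> v ` H" for H
    using inj_image_subset_iff[OF bij_is_inj[OF W_bij[OF v]], of "(inv_map v \<circ> u) ` Z" H] by (simp only: vu)
  have **: "separates H c0 ((inv_map v \<circ> u) c0) \<longleftrightarrow> separates (v ` H) (v c0) (u c0)" for H
    using W_separates[OF v, of H c0 "(inv_map v \<circ> u) c0"] by (simp add: W_inv[OF v])
  have "(\<forall>H\<in>A. P (v ` H)) \<longleftrightarrow> (\<forall>H\<in>A. P H)" for P
  proof
    assume P: "\<forall>H\<in>A. P (v ` H)"
    show "\<forall>H\<in>A. P H"
    proof
      fix H assume "H \<in> A"
      then have "P (v ` inv_map v ` H)" using P W_image_A[OF W_inverse[OF v]] by blast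
      then show "P H" by (simp only: inv_map_image(2)[OF v])
    qed
  qed (use W_image_A[OF v] in blast)
  from this[of "\<lambda>H. u ` Z \<subseteq> H \<longrightarrow> \<not> separates H (v c0) (u c0)"]
  show ?thesis unfolding * ** .
qed

lemma localized_chamber_W:
  assumes "w \<in> W"
  shows "localized_chamber A I F (w ` interior K) = cell (localized_arr A F) I (w c0)"
  using convex_I A_hyperplane
proof (rule localized_chamber_eq)
  show "w ` interior K \<in> chambers A I" using assms chambers_A by blast
  show "w c0 \<in> w ` interior K" using c0 by blast
qed

text \<open>The hypothesis on the localized arrangements makes the left chamber the finer one, so
  inclusion only asks that the base points \<open>v c0\<close> and \<open>u c0\<close> agree on the
  hyperplanes containing \<open>F\<close>.\<close>

lemma localized_chamber_subset_iff:
  assumes u: "u \<in> W" and v: "v \<in> W" and sub: "localized_arr A F \<subseteq> localized_arr A F'"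
  shows "localized_chamber A I F' (v ` interior K) \<subseteq> localized_chamber A I F (u ` interior K)
    \<longleftrightarrow> (\<forall>H\<in>A. F \<subseteq> H \<longrightarrow> \<not> separates H (v c0) (u c0))"
  unfolding localized_chamber_W[OF u] localized_chamber_W[OF v]
proof
  assume s: "cell (localized_arr A F') I (v c0) \<subseteq> cell (localized_arr A F) I (u c0)"
  have "v c0 \<in> cell (localized_arr A F') I (v c0)"
    using W_c0[OF v] A_hyperplane by (intro mem_cell_self) (auto simp: localized_arr_def)
  then show "\<forall>H\<in>A. F \<subseteq> H \<longrightarrow> \<not> separates H (v c0) (u c0)"
    using s by (auto simp: cell_def localized_arr_def separates_sym)
next
  assume ns: "\<forall>H\<in>A. F \<subseteq> H \<longrightarrow> \<not> separates H (v c0) (u c0)"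
  show "cell (localized_arr A F') I (v c0) \<subseteq> cell (localized_arr A F) I (u c0)"
  proof
    fix x assume x: "x \<in> cell (localized_arr A F') I (v c0)"
    have "(x \<in> H \<longleftrightarrow> u c0 \<in> H) \<and> \<not> separates H (u c0) x" if H: "H \<in> localized_arr A F" for H
    proof -
      have HA: "H \<in> A" "F \<subseteq> H" using H by (auto simp: localized_arr_def)
      have n: "u c0 \<notin> H" "v c0 \<notin> H" using W_c0 u v HA(1) by blast+
      have "x \<in> H \<longleftrightarrow> v c0 \<in> H" "\<not> separates H (v c0) x" using x H sub by (auto simp: cell_def)
      moreover have "\<not> separates H (v c0) (u c0)" using ns HA by blast
      ultimately show ?thesis
        using n separates_trans[OF A_hyperplane[OF HA(1)], of "v c0" "u c0" x] by blast
    qed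
    then show "x \<in> cell (localized_arr A F) I (u c0)" using x by (simp add: cell_def)
  qed
qed

lemma inv_GL_eq:
  assumes "v \<in> W"
  shows "inv\<^bsub>GL\<^esub> v = inv_map v"
proof (rule group.inv_equality[OF group_GL])
  show "inv_map v \<otimes>\<^bsub>GL\<^esub> v = \<one>\<^bsub>GL\<^esub>" using W_inv_comp(1)[OF assms] by (simp add: GL_def)
qed (use W_linear W_bij W_inverse assms in \<open>auto simp: GL_def\<close>)

text \<open>If the closure relation holds, \<open>inv_map u \<circ> v\<close> moves a point of
  \<open>face Y\<close> within \<open>K\<close>, so by \<open>stabilizer\<close> it fixes that point
  and lies in the parabolic subgroup of \<open>Y\<close>; the point then lies on all walls in
  \<open>X\<close>. Conversely, that subgroup fixes \<open>face Y\<close> pointwise, so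
  \<open>u\<close> and \<open>v\<close> have the same effect on it.\<close>

lemma closure_facet_iff:
  assumes u: "u \<in> W" "X \<in> finite_type_subsets S" and v: "v \<in> W" "Y \<in> finite_type_subsets S"
  shows "facet_le I (v ` face Y) (u ` face X) \<longleftrightarrow> X \<subseteq> Y \<and> inv_map v \<circ> u \<in> gen_subgroup Y"
proof
  assume le: "facet_le I (v ` face Y) (u ` face X)"
  obtain p where p: "p \<in> face Y" "p \<in> K" "walls_at p = Y" using face_eq_cell[OF v(2)] by blast
  define g where "g = inv_map u \<circ> v"
  have g: "g \<in> W" unfolding g_def using W_comp[OF W_inverse[OF u(1)] v(1)] .
  have "v p \<in> u ` closure (face X)"
    using le p(1) by (auto simp: facet_le_def closure_W_image[OF u(1)])
  then have gp: "g p \<in> closure (face X)" by (simp add: mem_image_W[OF u(1)] g_def)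
  moreover have "closure (face X) \<subseteq> K"
    using face_subset_K polyhedron_imp_closed[OF polyhedron_K] by (rule closure_minimal)
  ultimately have st: "g p = p" "g \<in> gen_subgroup (walls_at p)" using stabilizer[OF p(2) g] by blast+
  have YS: "Y \<subseteq> S" and XS: "X \<subseteq> S" using v(2) u(2) finite_type_subset by auto
  have "g \<in> gen_subgroup Y" using st(2) by (simp only: p(3))
  then have "inv_map g \<in> gen_subgroup Y" by (rule gen_inv[OF YS])
  moreover have "inv_map g = inv_map v \<circ> u"
    by (rule inv_unique_comp) (auto simp: g_def W_inv u(1) v(1))
  moreover have "X \<subseteq> walls_at p"
    using closure_face_fixed[OF XS] gp st(1) XS by auto
  then have "X \<subseteq> Y" by (simp only: p(3))
  ultimately show "X \<subseteq> Y \<and> inv_map v \<circ> u \<in> gen_subgroup Y" by simp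
next
  assume a: "X \<subseteq> Y \<and> inv_map v \<circ> u \<in> gen_subgroup Y"
  have YS: "Y \<subseteq> S" using v(2) by (rule finite_type_subset)
  have "u ` face Y = v ` face Y"
  proof -
    have "u ` face Y = v ` (inv_map v \<circ> u) ` face Y"
      unfolding image_comp[symmetric] by (rule inv_map_image(2)[OF v(1), symmetric])
    also have "(inv_map v \<circ> u) ` face Y = face Y"
      using gen_fixes_face[OF YS, of "inv_map v \<circ> u"] a by (auto simp: image_def)
    finally show ?thesis .
  qed
  moreover have "face Y \<subseteq> closure (face X)"
    using a face_nonempty[OF finite_type_subset finite_type_finite, OF u(2) u(2)]
    by (intro face_subset_closure) auto
  then have "u ` face Y \<subseteq> closure (u ` face X)" unfolding closure_W_image[OF u(1)] by (rule image_mono)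
  moreover have "face Y \<subseteq> I" using face_subset_I[OF YS finite_type_finite[OF v(2)]] .
  then have "v ` face Y \<subseteq> I" using W_image_I[OF v(1)] by blast
  ultimately show "facet_le I (v ` face Y) (u ` face X)" by (simp add: facet_le_def)
qed

lemma WSf_le_iff_Sal0_le:
  assumes u: "u \<in> W" "X \<in> finite_type_subsets S" and v: "v \<in> W" "Y \<in> finite_type_subsets S"
  shows "WSf_le S (u, X) (v, Y) \<longleftrightarrow> Sal0_le A I (phi K S (v, Y)) (phi K S (u, X))"
proof -
  have w: "inv_map v \<circ> u \<in> W" using W_comp[OF W_inverse[OF v(1)] u(1)] .
  have arr: "localized_arr A (u ` face X) \<subseteq> localized_arr A (v ` face Y)"
    if "facet_le I (v ` face Y) (u ` face X)"
  proof
    fix H assume H: "H \<in> localized_arr A (u ` face X)"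
    have "closed H" using A_hyperplane[of H] H linear_hyperplane_subspace closed_subspace
      by (auto simp: localized_arr_def)
    then have "closure (u ` face X) \<subseteq> H"
      using H by (intro closure_minimal) (auto simp: localized_arr_def)
    then show "H \<in> localized_arr A (v ` face Y)"
      using that H unfolding facet_le_def localized_arr_def by blast
  qed
  have "WSf_le S (u, X) (v, Y) \<longleftrightarrow>
      facet_le I (v ` face Y) (u ` face X) \<and> empty_minimal S X (inv_map v \<circ> u)"
    unfolding WSf_le_def closure_facet_iff[OF u v] using inv_GL_eq[OF v(1)] by (simp add: GL_def)
  also have "\<dots> \<longleftrightarrow> facet_le I (v ` face Y) (u ` face X) \<and>
      (\<forall>H\<in>A. u ` face X \<subseteq> H \<longrightarrow> \<not> separates H (v c0) (u c0))"
    unfolding minimal_iff_not_separated[OF u(2) w] not_separated_translate[OF u(1) v(1)] ..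
  also have "\<dots> \<longleftrightarrow> Sal0_le A I (v ` face Y, v ` interior K) (u ` face X, u ` interior K)"
    using arr localized_chamber_subset_iff[OF u(1) v(1)] by (auto simp: Sal0_le_def)
  finally show ?thesis by (simp only: phi_eq u(2) v(2))
qed

end

theorem theorem3p3:
  fixes K :: "'a::euclidean_space set" and S :: "('a \<Rightarrow> 'a) set"
  assumes "vinberg_system K S"
  shows "bij_betw (phi K S) (gen_subgroup S \<times> finite_type_subsets S)
           (Sal0 (coxeter_arrangement S) (tits_cone K S))
       \<and> (\<forall>p \<in> gen_subgroup S \<times> finite_type_subsets S.
          \<forall>q \<in> gen_subgroup S \<times> finite_type_subsets S.
            WSf_le S p q \<longleftrightarrow>
            Sal0_le (coxeter_arrangement S) (tits_cone K S) (phi K S q) (phi K S p))"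
proof -
  interpret vinberg K S by unfold_locales (rule assms)
  show ?thesis
    using inj_on_phi phi_image WSf_le_iff_Sal0_le by (auto simp: bij_betw_def)
qed

end
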